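(* Let $\mathcal{G}$ be either the Kronecker snake graph $\mathcal{G}_s$ ($s\ge0$) or $\mathcal{H}_s$ ($s\geq 1$). Then for all integers $u,w\ge 0$, $$\sum_{P\in\mathcal{P}(\mathcal{G}):\ \dim P=(u,w)}q^{\frac{\alpha(P)}{2}}=\sum_{P\in\mathcal{P}(\mathcal{G}):\ \dim P=(u,w)}q^{\frac{v(P)}{2}}.$$ Consequently the two expansion formulas for the quantum cluster variables of Kronecker type coincide: $$\sum_{P\in \mathcal{P}(\mathcal{G}_s)}q^{\frac{\alpha(P)}{2}}X(P)=\sum_{P\in \mathcal{P}(\mathcal{G}_s)}q^{\frac{v(P)}{2}}X(P).$$
   Context: **Snake graphs (Kronecker quiver $1\rightrightarrows2$).** $\mathcal{G}_s$ is the straight horizontal row of $2s+1$ unit square tiles $G_{-s},G_{-s+1},\dots,G_s$ (left to right, consecutive tiles sharing a vertical edge) with alternating face weights (diagonal labels) $1,2,1,\dots,2,1$, so $s+1$ tiles have weight $1$ and $s$ have weight $2$. $\mathcal{H}_s$ is obtained from $\mathcal{G}_s$ by removing the last (rightmost) tile; its tiles are denoted $H_{-s},\dots,H_{s-1}$ from left to right. The top and bottom edges of a tile of weight $1$ are labeled $2$, those of a tile of weight $2$ are labeled $1$; vertical edges are labeled by boundary arcs (variable $1$). **Matchings.** $\mathcal{P}(\mathcal{G})$ is the set of perfect matchings of $\mathcal{G}$. The minimal matching $P_-$ is the perfect matching consisting of boundary edges only and containing the leftmost vertical edge (so it contains the top and bottom edges of all tiles of weight $2$); the maximal matching $P_+$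 is the other perfect matching with only boundary edges. For $P\in\mathcal{P}(\mathcal{G})$, $\mathrm{Twist}(P)$ is the set of tiles enclosed by the symmetric difference of $P$ and $P_-$, and $\dim P=(u,w)$ where $u$, $w$ are the numbers of tiles of weight $1$, $2$ in $\mathrm{Twist}(P)$. $P$ can twist on a tile $p$ if two edges of $p$ belong to $P$; then $\mu_p(P)$ is obtained by replacing them by the other two edges of $p$. **The map $\alpha$.** $\alpha(G_i)=i$ if $G_i$ has weight $1$ and $-i$ if it has weight $2$; $\alpha(H_i)=i+1$ if $H_i$ has weight $1$ and $-i$ if it has weight $2$. Put $\alpha(P)=\sum_{G\in\mathrm{Twist}(P)}\alpha(G)$. **The map $v$.** $v:\mathcal{P}(\mathcal{G})\to\mathbb{Z}$ is the unique map with $v(P_-)=v(P_+)=0$ and $v(P)-v(\mu_p(P))=\Omega(p,P)$ whenever $P$ can twist on $p$. Here, with $k$ the weight of $p$, $m^{+}$ (resp. $m^-$) the number of tiles of weight $k$ strictly to the right (resp. left) of $p$, and $n^+$ (resp. $n^-$) the number of edges of $P$ labeled $k$ in the tiles strictly to the right (resp. left) of $p$, $\Omega(p,P)=n^+-m^+-n^-+m^-$ if $p\in\mathrm{Twist}(P)$, and $\Omega(p,P)=-(n^+-m^+-n^-+m^-)$ otherwise. **$X(P)$.** In the rank-2 quantum torus with basis $X^g$ ($g\in\mathbb{Z}^2$) and product $X^gX^h=q^{\Lambda(g,h)/2}X^{g+h}$, for the skew-symmetric form $\Lambda$ of the quantum cluster algebra of the Kronecker quiver, $X(P)=X^{a(P)}$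 where $a(P)_k=\#\{\text{edges of }P\text{ labeled }k\}-\#\{\text{tiles of weight }k\}$, $k=1,2$. *)

theory Defs
  imports Complex_Main "HOL-Library.Poly_Mapping" "HOL-Library.Product_Plus"
begin

section \<open>Kronecker snake graphs\<close>

datatype snake = Gsnake nat | Hsnake nat

fun leftmost :: "snake \<Rightarrow> int" where
  "leftmost (Gsnake s) = - int s"
| "leftmost (Hsnake s) = - int s"

fun tiles :: "snake \<Rightarrow> int set" where
  "tiles (Gsnake s) = {- int s..int s}"
| "tiles (Hsnake s) = {- int s..int s - 1}"

text \<open>Weights alternate along the row and start with 1 at the leftmost tile.\<close>

definition weight :: "snake \<Rightarrow> int \<Rightarrow> nat" where
  "weight \<G> i = (if even (i - leftmost \<G>) then 1 else 2)"

text \<open>Tile \<open>i\<close> is the unit square with corners \<open>(i, 0)\<close>, \<open>(i + 1, 0)\<close>, \<open>(i + 1, 1)\<close>, \<open>(i, 1)\<close>.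
  The edge \<open>Vert i\<close> is its left side, hence also the right side of tile \<open>i - 1\<close>.\<close>

datatype edge = Bot int | Top int | Vert int

fun ends :: "edge \<Rightarrow> (int \<times> int) set" where
  "ends (Bot i) = {(i, 0), (i + 1, 0)}"
| "ends (Top i) = {(i, 1), (i + 1, 1)}"
| "ends (Vert i) = {(i, 0), (i, 1)}"

definition tile_edges :: "int \<Rightarrow> edge set" where
  "tile_edges i = {Bot i, Top i, Vert i, Vert (i + 1)}"

definition edges :: "snake \<Rightarrow> edge set" where
  "edges \<G> = (\<Union>i\<in>tiles \<G>. tile_edges i)"

definition vertices :: "snake \<Rightarrow> (int \<times> int) set" where
  "vertices \<G> = (\<Union>e\<in>edges \<G>. ends e)"

text \<open>Edge labels; \<open>None\<close> stands for a boundary arc of the surface, whose variable is 1.\<close>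

fun edge_label :: "snake \<Rightarrow> edge \<Rightarrow> nat option" where
  "edge_label \<G> (Bot i) = Some (if weight \<G> i = 1 then 2 else 1)"
| "edge_label \<G> (Top i) = Some (if weight \<G> i = 1 then 2 else 1)"
| "edge_label \<G> (Vert i) = None"

definition boundary_edges :: "snake \<Rightarrow> edge set" where
  "boundary_edges \<G> = {e \<in> edges \<G>. \<exists>!i. i \<in> tiles \<G> \<and> e \<in> tile_edges i}"


section \<open>Perfect matchings\<close>

definition matchings :: "snake \<Rightarrow> edge set set" where
  "matchings \<G> = {P. P \<subseteq> edges \<G> \<and> (\<forall>x\<in>vertices \<G>. \<exists>!e. e \<in> P \<and> x \<in> ends e)}"

definition P_min :: "snake \<Rightarrow> edge set" where
  "P_min \<G> = (THE P. P \<in> matchings \<G> \<and> P \<subseteq> boundary_edges \<G> \<and> Vert (leftmost \<G>) \<in> P)"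

definition P_max :: "snake \<Rightarrow> edge set" where
  "P_max \<G> = (THE P. P \<in> matchings \<G> \<and> P \<subseteq> boundary_edges \<G> \<and> P \<noteq> P_min \<G>)"

text \<open>The tiles that can be joined to the unbounded face without crossing an edge of \<open>D\<close>:
  one leaves a tile through a boundary edge, or passes to a neighbouring tile through a
  common edge. All other tiles are enclosed by \<open>D\<close>.\<close>

inductive_set outside :: "snake \<Rightarrow> edge set \<Rightarrow> int set" for \<G> D where
  exit: "i \<in> tiles \<G> \<Longrightarrow> e \<in> tile_edges i \<Longrightarrow> e \<in> boundary_edges \<G> \<Longrightarrow> e \<notin> D \<Longrightarrow> i \<in> outside \<G> D"
| cross: "j \<in> outside \<G> D \<Longrightarrow> i \<in> tiles \<G> \<Longrightarrow> e \<in> tile_edges i \<Longrightarrow> e \<in> tile_edges j \<Longrightarrow> e \<notin> D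
    \<Longrightarrow> i \<in> outside \<G> D"

definition Twist :: "snake \<Rightarrow> edge set \<Rightarrow> int set" where
  "Twist \<G> P = tiles \<G> - outside \<G> (sym_diff P (P_min \<G>))"

definition dimP :: "snake \<Rightarrow> edge set \<Rightarrow> nat \<times> nat" where
  "dimP \<G> P = (card {i \<in> Twist \<G> P. weight \<G> i = 1}, card {i \<in> Twist \<G> P. weight \<G> i = 2})"

definition can_twist :: "snake \<Rightarrow> edge set \<Rightarrow> int \<Rightarrow> bool" where
  "can_twist \<G> P p \<longleftrightarrow> p \<in> tiles \<G> \<and> card (tile_edges p \<inter> P) = 2"

definition twist :: "int \<Rightarrow> edge set \<Rightarrow> edge set" where
  "twist p P = sym_diff P (tile_edges p)"


section \<open>The maps alpha and v\<close>

fun alpha_tile :: "snake \<Rightarrow> int \<Rightarrow> int" where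
  "alpha_tile (Gsnake s) i = (if weight (Gsnake s) i = 1 then i else - i)"
| "alpha_tile (Hsnake s) i = (if weight (Hsnake s) i = 1 then i + 1 else - i)"

definition alpha :: "snake \<Rightarrow> edge set \<Rightarrow> int" where
  "alpha \<G> P = (\<Sum>i\<in>Twist \<G> P. alpha_tile \<G> i)"

text \<open>With \<open>S\<close> the set of tiles strictly to the right (left) of \<open>p\<close>, these are the numbers
  \<open>m\<close> and \<open>n\<close> with superscript plus (minus).\<close>

definition num_tiles :: "snake \<Rightarrow> nat \<Rightarrow> int set \<Rightarrow> int" where
  "num_tiles \<G> k S = int (card {i \<in> S. weight \<G> i = k})"

definition num_edges :: "snake \<Rightarrow> nat \<Rightarrow> int set \<Rightarrow> edge set \<Rightarrow> int" where
  "num_edges \<G> k S P = int (card {e \<in> P. edge_label \<G> e = Some k \<and> (\<exists>i\<in>S. e \<in> tile_edges i)})"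

definition Omega :: "snake \<Rightarrow> int \<Rightarrow> edge set \<Rightarrow> int" where
  "Omega \<G> p P =
    (let k = weight \<G> p;
         R = {i \<in> tiles \<G>. p < i};
         L = {i \<in> tiles \<G>. i < p};
         d = num_edges \<G> k R P - num_tiles \<G> k R - num_edges \<G> k L P + num_tiles \<G> k L
     in if p \<in> Twist \<G> P then d else - d)"

text \<open>The condition outside \<open>matchings \<G>\<close> only turns a map on matchings into a total function.\<close>

definition is_v :: "snake \<Rightarrow> (edge set \<Rightarrow> int) \<Rightarrow> bool" where
  "is_v \<G> f \<longleftrightarrow>
     f (P_min \<G>) = 0 \<and> f (P_max \<G>) = 0 \<and>
     (\<forall>P\<in>matchings \<G>. \<forall>p. can_twist \<G> P p \<longrightarrow> f P - f (twist p P) = Omega \<G> p P) \<and>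
     (\<forall>P. P \<notin> matchings \<G> \<longrightarrow> f P = 0)"

definition v :: "snake \<Rightarrow> edge set \<Rightarrow> int" where
  "v \<G> = (THE f. is_v \<G> f)"


section \<open>The quantum torus\<close>

text \<open>Integer combinations of formal powers of \<open>q\<close>. All rational exponents are admitted, so
  that every rational normalisation of the form \<open>\<Lambda>\<close> below is covered; the subring spanned by
  the exponents in \<open>\<int>/2\<close> is the ring of Laurent polynomials in the square root of \<open>q\<close>.\<close>

type_synonym qcoeff = "rat \<Rightarrow>\<^sub>0 int"

definition qpow :: "rat \<Rightarrow> qcoeff" where
  "qpow r = Poly_Mapping.single r 1"

text \<open>Skew-symmetric bilinear forms compatible with the exchange matrix of the quiver with two
  arrows from 1 to 2, whose columns are \<open>(0, -2)\<close> and \<open>(2, 0)\<close>: column \<open>j\<close> pairs with the \<open>i\<close>-th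
  unit vector to \<open>d\<close> if \<open>i = j\<close> and to 0 otherwise. The sign of \<open>d\<close> is left free since it
  depends on the sign convention for the exchange matrix.\<close>

definition kronecker_form :: "(int \<times> int \<Rightarrow> int \<times> int \<Rightarrow> rat) \<Rightarrow> bool" where
  "kronecker_form \<Lambda> \<longleftrightarrow>
     (\<forall>g h. \<Lambda> h g = - \<Lambda> g h) \<and>
     (\<forall>g g' h. \<Lambda> (g + g') h = \<Lambda> g h + \<Lambda> g' h) \<and>
     (\<exists>d. d \<noteq> 0 \<and>
        \<Lambda> (0, -2) (1, 0) = d \<and> \<Lambda> (0, -2) (0, 1) = 0 \<and>
        \<Lambda> (2, 0) (1, 0) = 0 \<and> \<Lambda> (2, 0) (0, 1) = d)"

lemma kronecker_form_standard:
  "c \<noteq> 0 \<Longrightarrow> kronecker_form (\<lambda>g h. c * of_int (fst g * snd h - snd g * fst h))"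
  unfolding kronecker_form_def by (auto simp: algebra_simps)

type_synonym qtorus = "(int \<times> int) \<Rightarrow>\<^sub>0 qcoeff"

definition X_basis :: "int \<times> int \<Rightarrow> qtorus" where
  "X_basis g = Poly_Mapping.single g 1"

definition qscalar :: "qcoeff \<Rightarrow> qtorus" where
  "qscalar c = Poly_Mapping.single 0 c"

definition qt_mult :: "(int \<times> int \<Rightarrow> int \<times> int \<Rightarrow> rat) \<Rightarrow> qtorus \<Rightarrow> qtorus \<Rightarrow> qtorus" where
  "qt_mult \<Lambda> x y =
     (\<Sum>g\<in>Poly_Mapping.keys x. \<Sum>h\<in>Poly_Mapping.keys y.
        Poly_Mapping.single (g + h)
          (Poly_Mapping.lookup x g * Poly_Mapping.lookup y h * qpow (\<Lambda> g h / 2)))"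

lemma qt_mult_X_basis:
  "qt_mult \<Lambda> (X_basis g) (X_basis h) = qt_mult \<Lambda> (qscalar (qpow (\<Lambda> g h / 2))) (X_basis (g + h))"
  if "kronecker_form \<Lambda>"
proof -
  have "\<Lambda> (0 + 0) (g + h) = \<Lambda> 0 (g + h) + \<Lambda> 0 (g + h)"
    using that unfolding kronecker_form_def by blast
  then have "\<Lambda> 0 (g + h) = 0"
    by simp
  then show ?thesis
    by (simp add: qt_mult_def X_basis_def qscalar_def qpow_def)
qed

definition a_vec :: "snake \<Rightarrow> edge set \<Rightarrow> int \<times> int" where
  "a_vec \<G> P =
     (int (card {e \<in> P. edge_label \<G> e = Some 1}) - int (card {i \<in> tiles \<G>. weight \<G> i = 1}),
      int (card {e \<in> P. edge_label \<G> e = Some 2}) - int (card {i \<in> tiles \<G>. weight \<G> i = 2}))"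

definition X_matching :: "snake \<Rightarrow> edge set \<Rightarrow> qtorus" where
  "X_matching \<G> P = X_basis (a_vec \<G> P)"

end

(* A perfect matching of a row of tiles is determined by the set S of tiles matched by their two
   horizontal edges, and the sets that occur are those without two consecutive tiles. Let A and C be
   the parts of S of weight 1 and 2. Up to the same constant depending only on |A|, alpha(P) is the
   sum of A plus the sum of C, and the twist relations integrate to
     v(P) = (sum of A) - (sum of C) - 2 * (sum over a in A, c in C of sgn(a - c)).
   Replacing the k-th smallest element s of S (k = 0, 1, ...) by s - 2k turns the sets S into all
   multisets of size |S| on a shorter interval and preserves parity, hence the weights. There the
   parts of weight 1 and 2 vary independently, and the interaction term becomes a constant: alpha(P)
   and v(P) are the sum of the two parts and their difference, respectively, plus constants.
   Reflecting the part of weight 2 exchanges them without changing dim P. *)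
theory Submission
  imports Defs "HOL-Library.Multiset"
begin

section \<open>Compressing sparse sets to multisets\<close>

definition sparse :: "int set \<Rightarrow> bool" where
  "sparse S \<longleftrightarrow> (\<forall>i\<in>S. i + 1 \<notin> S)"

definition rank :: "int set \<Rightarrow> int \<Rightarrow> int" where
  "rank S i = int (card {j \<in> S. j < i})"

text \<open>In a sparse set consecutive elements differ by at least 2. Lowering the k-th smallest by
  2k, with k counted from 0, leaves gaps of at least 0, so values may coincide and the result is a
  multiset. The shift is even and so keeps parities.\<close>

definition compress :: "int set \<Rightarrow> int multiset" where
  "compress S = image_mset (\<lambda>i. i - 2 * rank S i) (mset_set S)"

lemma sparse_empty [simp]: "sparse {}"
  by (simp add: sparse_def)

text \<open>Serves the inductions below, which build a set by adding a new largest element each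
  time.\<close>

lemma sparse_insert_max:
  assumes "\<forall>i\<in>S. i < m"
  shows "sparse (insert m S) \<longleftrightarrow> sparse S \<and> (\<forall>i\<in>S. i \<le> m - 2)"
  using assms by (force simp: sparse_def)

lemma sparse_insert:
  assumes "sparse S" "p - 1 \<notin> S" "p + 1 \<notin> S"
  shows "sparse (insert p S)"
  using assms by (force simp: sparse_def)

lemma sparse_subset: "sparse S \<Longrightarrow> T \<subseteq> S \<Longrightarrow> sparse T"
  by (auto simp: sparse_def)

lemma rank_nonneg: "0 \<le> rank S i"
  by (simp add: rank_def)

lemma rank_less_card:
  assumes "finite S" "i \<in> S"
  shows "rank S i < int (card S)"
proof -
  have "{j \<in> S. j < i} \<subset> S" using assms by auto
  then show ?thesis using assms by (simp add: rank_def psubset_card_mono)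
qed

lemma rank_max:
  assumes "\<forall>i\<in>S. i < m"
  shows "rank (insert m S) m = int (card S)"
proof -
  have "{j \<in> insert m S. j < m} = S" using assms by auto
  then show ?thesis by (simp add: rank_def)
qed

lemma rank_insert_above: "i < m \<Longrightarrow> rank (insert m S) i = rank S i"
  unfolding rank_def by (rule arg_cong[of _ _ "\<lambda>x. int (card x)"]) auto

lemma rank_Un:
  assumes "finite S" "finite T" "S \<inter> T = {}"
  shows "rank (S \<union> T) i = rank S i + rank T i"
proof -
  have "{j \<in> S \<union> T. j < i} = {j \<in> S. j < i} \<union> {j \<in> T. j < i}" by auto
  moreover have "{j \<in> S. j < i} \<inter> {j \<in> T. j < i} = {}" using assms by auto
  ultimately show ?thesis using assms by (simp add: rank_def card_Un_disjoint)
qed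

text \<open>The ranks of the elements of S are 0, 1, ..., |S| - 1; doubling avoids a
  division.\<close>

lemma sum_rank:
  assumes "finite S"
  shows "2 * (\<Sum>i\<in>S. rank S i) = int (card S) * (int (card S) - 1)"
  using assms
proof (induction rule: finite_linorder_max_induct)
  case empty
  then show ?case by simp
next
  case (insert m S)
  have "m \<notin> S" using insert by auto
  moreover have "(\<Sum>i\<in>S. rank (insert m S) i) = (\<Sum>i\<in>S. rank S i)"
    using insert by (intro sum.cong) (auto simp: rank_insert_above)
  ultimately show ?case
    using insert by (simp add: rank_max algebra_simps)
qed

text \<open>Since sgn(a - c) = [c < a] - [a < c], the interaction term is a difference of ranks of
  one set in the other. In this form it can cancel against the shifts made by
  \<open>compress\<close>.\<close>

lemma sum_sgn_diff:
  fixes S T :: "int set"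
  assumes "finite S" "finite T"
  shows "(\<Sum>a\<in>S. \<Sum>c\<in>T. sgn (a - c)) = (\<Sum>a\<in>S. rank T a) - (\<Sum>c\<in>T. rank S c)"
proof -
  have r: "rank X i = (\<Sum>j\<in>X. of_bool (j < i))" if "finite X" for X i
    using that by (simp add: rank_def sum_of_bool_eq Int_def)
  have "(\<Sum>a\<in>S. \<Sum>c\<in>T. sgn (a - c)) =
      (\<Sum>a\<in>S. \<Sum>c\<in>T. of_bool (c < a)) - (\<Sum>a\<in>S. \<Sum>c\<in>T. of_bool (a < c))"
    unfolding sum_subtractf[symmetric] by (intro sum.cong) (auto simp: sgn_if)
  also have "(\<Sum>a\<in>S. \<Sum>c\<in>T. of_bool (a < c)) = (\<Sum>c\<in>T. \<Sum>a\<in>S. (of_bool (a < c) :: int))"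
    by (rule sum.swap)
  finally show ?thesis using assms by (simp add: r)
qed

lemma compress_empty [simp]: "compress {} = {#}"
  by (simp add: compress_def)

lemma size_compress [simp]: "size (compress S) = card S"
  by (simp add: compress_def)

lemma in_compress: "finite S \<Longrightarrow> i \<in> S \<Longrightarrow> i - 2 * rank S i \<in># compress S"
  by (simp add: compress_def)

lemma compress_insert_max:
  assumes "finite S" "\<forall>i\<in>S. i < m"
  shows "compress (insert m S) = add_mset (m - 2 * int (card S)) (compress S)"
proof -
  have "m \<notin> S" using assms by auto
  moreover have "image_mset (\<lambda>i. i - 2 * rank (insert m S) i) (mset_set S)
      = image_mset (\<lambda>i. i - 2 * rank S i) (mset_set S)"
    using assms by (intro image_mset_cong) (auto simp: rank_insert_above)
  ultimately show ?thesis using assms by (simp add: compress_def rank_max)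
qed

text \<open>The bound is the value that a new largest element \<open>m\<close> would be sent to, so
  the lemma expresses that compression is weakly increasing.\<close>

lemma compress_upper:
  assumes "finite S" "sparse S" "\<forall>i\<in>S. i \<le> m - 2" "t \<in># compress S"
  shows "t \<le> m - 2 * int (card S)"
  using assms
proof (induction arbitrary: m rule: finite_linorder_max_induct)
  case empty
  then show ?case by simp
next
  case (insert b S)
  have "b \<notin> S" using insert by auto
  have S: "sparse S" "\<forall>i\<in>S. i \<le> b - 2"
    using insert.prems(1) insert.hyps by (auto simp: sparse_insert_max)
  have "t \<le> b - 2 * int (card S)"
    using insert.prems(3) insert.hyps insert.IH[OF S] by (auto simp: compress_insert_max)
  then show ?case using insert \<open>b \<notin> S\<close> by auto
qed

text \<open>The smallest element has rank 0 and stays in place, and compression is weakly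
  increasing.\<close>

lemma compress_lower:
  assumes "finite S" "sparse S" "\<forall>i\<in>S. l \<le> i" "t \<in># compress S"
  shows "l \<le> t"
  using assms
proof (induction arbitrary: t rule: finite_linorder_max_induct)
  case empty
  then show ?case by simp
next
  case (insert b S)
  have S: "sparse S" "\<forall>i\<in>S. i \<le> b - 2"
    using insert.prems(1) insert.hyps by (auto simp: sparse_insert_max)
  have IH: "l \<le> x" if "x \<in># compress S" for x
    using insert.IH[OF S(1)] insert.prems(2) that by simp
  \<comment> \<open>The new entry is at least every earlier one by \<open>compress_upper\<close>, so
    any earlier entry carries the lower bound over; without earlier entries \<open>b\<close> is
    unshifted.\<close>
  have "l \<le> b - 2 * int (card S)"
  proof (cases "S = {}")
    case True
    then show ?thesis using insert by simp
  next
    case False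
    then obtain x where "x \<in># compress S"
      using in_compress insert.hyps(1) by blast
    then show ?thesis
      using IH compress_upper[OF insert.hyps(1) S] by fastforce
  qed
  then show ?case using insert IH by (auto simp: compress_insert_max)
qed

text \<open>The largest element of a sparse set is sent to the maximum of the multiset, and the size
  of the multiset gives its rank. It can therefore be recovered and stripped off.\<close>

lemma compress_inject:
  assumes "finite S" "finite T" "sparse S" "sparse T" "compress S = compress T"
  shows "S = T"
  using assms
proof (induction arbitrary: T rule: finite_linorder_max_induct)
  case empty
  then have "card T = 0" by (metis size_compress card.empty)
  then show ?case using empty by simp
next
  case (insert m S)
  have card: "card T = Suc (card S)"
    using insert by (metis size_compress card_insert_disjoint order_less_irrefl)
  then have "T \<noteq> {}" by auto
  define n U where "n = Max T" and "U = T - {n}"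
  have T: "T = insert n U" and U: "finite U" "\<forall>i\<in>U. i < n"
    using Max_in[OF insert.prems(1) \<open>T \<noteq> {}\<close>] insert.prems(1)
    by (auto simp: n_def U_def order_less_le)
  have cU: "card U = card S" using card Max_in[OF insert.prems(1) \<open>T \<noteq> {}\<close>] by (simp add: U_def n_def)
  have s: "sparse S" "\<forall>i\<in>S. i \<le> m - 2" "sparse U" "\<forall>i\<in>U. i \<le> n - 2"
    using insert.prems insert.hyps U unfolding T by (auto simp: sparse_insert_max)
  have eq: "add_mset (m - 2 * int (card S)) (compress S) = add_mset (n - 2 * int (card S)) (compress U)"
    using insert.prems(4) insert.hyps U cU unfolding T by (simp add: compress_insert_max)
  \<comment> \<open>Each of the two added entries occurs in the other multiset, so it is the other
    added entry or is bounded by it through \<open>compress_upper\<close>.\<close>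
  have "n - 2 * int (card S) \<le> m - 2 * int (card S)"
    using eq compress_upper[OF insert.hyps(1) s(1,2)]
    by (metis union_single_eq_member insert_iff order_refl set_mset_add_mset_insert)
  moreover have "m - 2 * int (card S) \<le> n - 2 * int (card S)"
    using eq compress_upper[OF U(1) s(3,4)] cU
    by (metis union_single_eq_member insert_iff order_refl set_mset_add_mset_insert)
  ultimately have "m = n" by simp
  with eq have "compress S = compress U" by simp
  then have "S = U" using insert.IH U(1) s by blast
  then show ?case using T \<open>m = n\<close> by simp
qed

text \<open>A preimage is built from the smallest entry upwards: a new maximal entry x receives rank
  |S|, hence comes from x + 2|S|.\<close>

lemma compress_surj: "\<exists>S. finite S \<and> sparse S \<and> compress S = M"
proof (induction M rule: multiset_induct_max)
  case empty
  show ?case by (intro exI[of _ "{}"]) simp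
next
  case (add x M)
  then obtain S where S: "finite S" "sparse S" "compress S = M" by blast
  define m where "m = x + 2 * int (card S)"
  \<comment> \<open>The old entries are at most \<open>x\<close> and ranks in S are at most |S| - 1,
    which leaves the gap of 2 needed for sparseness.\<close>
  have below: "i \<le> m - 2" if "i \<in> S" for i
  proof -
    have "i - 2 * rank S i \<le> x" using in_compress[OF S(1) that] S(3) add by simp
    then show ?thesis using rank_less_card[OF S(1) that] by (simp add: m_def)
  qed
  then have "\<forall>i\<in>S. i < m" by force
  then have "finite (insert m S) \<and> sparse (insert m S) \<and> compress (insert m S) = add_mset x M"
    using S below by (simp add: compress_insert_max sparse_insert_max m_def)
  then show ?case by blast
qed

section \<open>Splitting by parity\<close>

text \<open>Parity is taken relative to the leftmost tile \<open>l\<close>, so for a set of tiles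
  \<open>ev\<close> and \<open>od\<close> are its parts of weight 1 and 2.\<close>

definition ev :: "int \<Rightarrow> int set \<Rightarrow> int set" where
  "ev l S = {i \<in> S. even (i - l)}"

definition od :: "int \<Rightarrow> int set \<Rightarrow> int set" where
  "od l S = {i \<in> S. odd (i - l)}"

lemma finite_ev_od [simp]: "finite S \<Longrightarrow> finite (ev l S)" "finite S \<Longrightarrow> finite (od l S)"
  by (simp_all add: ev_def od_def)

lemma ev_Un_od: "ev l S \<union> od l S = S" and ev_Int_od: "ev l S \<inter> od l S = {}"
  by (auto simp: ev_def od_def)

lemma card_ev_od: "finite S \<Longrightarrow> card (ev l S) + card (od l S) = card S"
  by (metis card_Un_disjoint ev_Int_od ev_Un_od finite_ev_od)

text \<open>Compression preserves parity, so each parity class of the multiset comes from one part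
  of S; the ranks are still those in all of S.\<close>

lemma filter_compress:
  assumes "finite S"
  shows "filter_mset (\<lambda>t. even (t - l)) (compress S) =
           image_mset (\<lambda>i. i - 2 * rank S i) (mset_set (ev l S))"
    and "filter_mset (\<lambda>t. odd (t - l)) (compress S) =
           image_mset (\<lambda>i. i - 2 * rank S i) (mset_set (od l S))"
  using assms by (simp_all add: compress_def filter_mset_image_mset ev_def od_def)

lemma sum_filter_compress:
  assumes "finite S"
  shows "sum_mset (filter_mset (\<lambda>t. even (t - l)) (compress S)) =
           \<Sum>(ev l S) - 2 * (\<Sum>i\<in>ev l S. rank S i)"
    and "sum_mset (filter_mset (\<lambda>t. odd (t - l)) (compress S)) =
           \<Sum>(od l S) - 2 * (\<Sum>i\<in>od l S. rank S i)"
  unfolding filter_compress[OF assms] sum_unfold_sum_mset[symmetric]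
  by (simp_all only: sum_subtractf sum_distrib_left)

text \<open>Compression lowers the total by twice the sum of all ranks, which depends only on
  |S|.\<close>

lemma sum_via_compress:
  assumes "finite S"
  shows "\<Sum>(ev l S) + \<Sum>(od l S) =
    sum_mset (filter_mset (\<lambda>t. even (t - l)) (compress S)) +
    sum_mset (filter_mset (\<lambda>t. odd (t - l)) (compress S)) +
    int (card S) * (int (card S) - 1)"
proof -
  have "(\<Sum>i\<in>S. rank S i) = (\<Sum>i\<in>ev l S. rank S i) + (\<Sum>i\<in>od l S. rank S i)"
    using assms by (metis sum.union_disjoint ev_Int_od ev_Un_od finite_ev_od)
  then show ?thesis using sum_rank[OF assms] sum_filter_compress[OF assms, of l] by simp
qed

text \<open>A rank in S is the rank within the own part plus the rank in the other part. The ranks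
  in the other part reproduce the sgn sum exactly, and those within the own part sum to
  constants.\<close>

lemma signed_sum_via_compress:
  assumes "finite S"
  shows "\<Sum>(ev l S) - \<Sum>(od l S) - 2 * (\<Sum>a\<in>ev l S. \<Sum>c\<in>od l S. sgn (a - c)) =
    sum_mset (filter_mset (\<lambda>t. even (t - l)) (compress S)) -
    sum_mset (filter_mset (\<lambda>t. odd (t - l)) (compress S)) +
    int (card (ev l S)) * (int (card (ev l S)) - 1) - int (card (od l S)) * (int (card (od l S)) - 1)"
proof -
  have r: "rank S i = rank (ev l S) i + rank (od l S) i" for i
    using assms by (metis rank_Un ev_Int_od ev_Un_od finite_ev_od)
  have fin: "finite (ev l S)" "finite (od l S)" using assms by simp_all
  show ?thesis
    unfolding sum_filter_compress[OF assms] sum_sgn_diff[OF fin] r sum.distrib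
    using sum_rank[OF fin(1)] sum_rank[OF fin(2)] by (simp add: algebra_simps)
qed

section \<open>Sparse subsets of an interval and bounded multisets\<close>

definition sparse_subsets :: "int \<Rightarrow> int \<Rightarrow> nat \<Rightarrow> nat \<Rightarrow> int set set" where
  "sparse_subsets l e u c =
     {S. S \<subseteq> {l..e} \<and> sparse S \<and> card (ev l S) = u \<and> card (od l S) = c}"

text \<open>The upper end is where \<open>e\<close> lands if it is the largest of
  \<open>u + c\<close> elements, hence of rank \<open>u + c - 1\<close>.\<close>

definition msets :: "int \<Rightarrow> int \<Rightarrow> nat \<Rightarrow> nat \<Rightarrow> int multiset set" where
  "msets l e u c = {M. set_mset M \<subseteq> {l..e - 2 * (int (u + c) - 1)} \<and>
     size (filter_mset (\<lambda>t. even (t - l)) M) = u \<and> size (filter_mset (\<lambda>t. odd (t - l)) M) = c}"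

lemma bij_betw_compress: "bij_betw compress (sparse_subsets l e u c) (msets l e u c)"
proof (rule bij_betw_imageI)
  have fin: "S \<subseteq> {l..e} \<Longrightarrow> finite S" for S using finite_subset by blast
  show "inj_on compress (sparse_subsets l e u c)"
    unfolding sparse_subsets_def by (intro inj_onI compress_inject) (auto dest: fin)
  show "compress ` sparse_subsets l e u c = msets l e u c"
  proof (intro equalityI subsetI)
    fix M assume "M \<in> compress ` sparse_subsets l e u c"
    then obtain S where S: "S \<subseteq> {l..e}" "sparse S" "card (ev l S) = u" "card (od l S) = c" "M = compress S"
      by (auto simp: sparse_subsets_def)
    have card: "card S = u + c" using card_ev_od[OF fin[OF S(1)], of l] S by simp
    \<comment> \<open>\<open>compress_upper\<close> is applied with \<open>m = e + 2\<close>, the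
      least position that a further element could always take.\<close>
    have S': "\<forall>i\<in>S. i \<le> (e + 2) - 2" "\<forall>i\<in>S. l \<le> i" using S(1) by auto
    have "l \<le> t \<and> t \<le> e + 2 - 2 * int (card S)" if "t \<in># compress S" for t
      using compress_upper[OF fin[OF S(1)] S(2) S'(1) that]
        compress_lower[OF fin[OF S(1)] S(2) S'(2) that] by simp
    then have "set_mset M \<subseteq> {l..e - 2 * (int (u + c) - 1)}" using S(5) card by force
    then show "M \<in> msets l e u c"
      unfolding msets_def mem_Collect_eq S(5) filter_compress[OF fin[OF S(1)]] using S by simp
  next
    fix M assume M: "M \<in> msets l e u c"
    obtain S where S: "finite S" "sparse S" "compress S = M" using compress_surj by blast
    have c: "card (ev l S) = u" "card (od l S) = c"
      using M unfolding msets_def mem_Collect_eq S(3)[symmetric] filter_compress[OF S(1)] by simp_all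
    then have card: "card S = u + c" using card_ev_od[OF S(1), of l] by simp
    \<comment> \<open>Undoing the compression raises an entry by twice its rank, that is by between
      0 and \<open>2 * (u + c - 1)\<close>.\<close>
    have "i \<in> {l..e}" if "i \<in> S" for i
    proof -
      have "i - 2 * rank S i \<in> {l..e - 2 * (int (u + c) - 1)}"
        using in_compress[OF S(1) that] M S(3) by (auto simp: msets_def)
      then show ?thesis
        using rank_less_card[OF S(1) that] rank_nonneg[of S i] card by auto
    qed
    then show "M \<in> compress ` sparse_subsets l e u c"
      using S c by (auto simp: sparse_subsets_def)
  qed
qed

text \<open>On the multisets the two parity classes are independent, and for \<open>e = - l\<close> or \<open>e = - l - 1\<close>
  the odd class fills an interval symmetric about \<open>r / 2\<close> with \<open>r = - 2 (n - 1)\<close>. Reflecting that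
  class alone is therefore an involution.\<close>

definition reflect_odd :: "int \<Rightarrow> int \<Rightarrow> int \<Rightarrow> int" where
  "reflect_odd l r t = (if even (t - l) then t else r - t)"

lemma reflect_odd_reflect_odd: "even r \<Longrightarrow> reflect_odd l r (reflect_odd l r t) = t"
  by (simp add: reflect_odd_def)

lemma filter_reflect_odd:
  assumes "even r"
  shows "filter_mset (\<lambda>t. even (t - l)) (image_mset (reflect_odd l r) M) = filter_mset (\<lambda>t. even (t - l)) M"
    and "filter_mset (\<lambda>t. odd (t - l)) (image_mset (reflect_odd l r) M) =
      image_mset (\<lambda>t. r - t) (filter_mset (\<lambda>t. odd (t - l)) M)"
  using assms by (induction M) (auto simp: reflect_odd_def)

lemma bij_betw_reflect_odd:
  assumes "e = - l \<or> e = - l - 1"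
  shows "bij_betw (image_mset (reflect_odd l (- 2 * (int (u + c) - 1)))) (msets l e u c) (msets l e u c)"
proof -
  define r where "r = - 2 * (int (u + c) - 1)"
  have r: "even r" by (simp add: r_def)
  have into: "image_mset (reflect_odd l r) M \<in> msets l e u c" if M: "M \<in> msets l e u c" for M
  proof -
    have "reflect_odd l r t \<in> {l..e + r}" if "t \<in># M" for t
    proof -
      have t: "l \<le> t" "t \<le> e + r" using that M by (auto simp: msets_def r_def)
      show ?thesis
      proof (cases "even (t - l)")
        case True
        then show ?thesis using t by (simp add: reflect_odd_def)
      next
        case False
        \<comment> \<open>An odd entry cannot be \<open>l\<close>. The gained 1 gives r - t \<le> r
          - l - 1 \<le> e + r, also if \<open>e = - l - 1\<close>; the lower bound follows from t
          \<le> e + r and -e \<ge> l.\<close>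
        then have "l + 1 \<le> t" using t(1) by (cases "t = l") auto
        then show ?thesis using t(2) False assms by (auto simp: reflect_odd_def)
      qed
    qed
    then have "set_mset (image_mset (reflect_odd l r) M) \<subseteq> {l..e - 2 * (int (u + c) - 1)}"
      unfolding set_image_mset image_subset_iff r_def by (simp add: algebra_simps)
    then show ?thesis
      using M unfolding msets_def mem_Collect_eq filter_reflect_odd[OF r] by simp
  qed
  have inv: "image_mset (reflect_odd l r) (image_mset (reflect_odd l r) M) = M" for M
    by (induction M) (simp_all add: reflect_odd_reflect_odd[OF r])
  show ?thesis
    unfolding r_def[symmetric]
    by (rule bij_betw_byWitness[where f' = "image_mset (reflect_odd l r)"]) (use into inv in auto)
qed

lemma sum_const_minus_mset: "sum_mset (image_mset (\<lambda>t. r - t) M) = int (size M) * r - sum_mset M"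
  by (induction M) (simp_all add: algebra_simps)

text \<open>Both sums are transported to multisets, where the reflection of the odd class exchanges
  the two statistics. A general \<open>g\<close> covers powers of q as well as their multiples of a
  fixed torus element.\<close>

lemma sum_sparse_subsets_eq:
  fixes g :: "int \<Rightarrow> 'b :: comm_monoid_add"
  assumes "e = - l \<or> e = - l - 1"
  shows "(\<Sum>S\<in>sparse_subsets l e u c. g (\<Sum>(ev l S) + \<Sum>(od l S))) =
    (\<Sum>S\<in>sparse_subsets l e u c.
       g (\<Sum>(ev l S) - \<Sum>(od l S) - 2 * (\<Sum>a\<in>ev l S. \<Sum>c\<in>od l S. sgn (a - c))))"
    (is "?L = ?R")
proof -
  let ?E = "\<lambda>M. sum_mset (filter_mset (\<lambda>t. even (t - l)) M)"
  let ?O = "\<lambda>M. sum_mset (filter_mset (\<lambda>t. odd (t - l)) M)"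
  let ?n = "int (u + c)"
  let ?h = "\<lambda>M. g (?E M + ?O M + ?n * (?n - 1))"
  let ?h' = "\<lambda>M. g (?E M - ?O M + int u * (int u - 1) - int c * (int c - 1))"
  let ?\<rho> = "image_mset (reflect_odd l (- 2 * (?n - 1)))"
  have ev: "even (- 2 * (?n - 1))" by simp
  have fin: "finite S" if "S \<in> sparse_subsets l e u c" for S
    using that finite_subset[of S "{l..e}"] by (auto simp: sparse_subsets_def)
  have "?L = (\<Sum>S\<in>sparse_subsets l e u c. ?h (compress S))"
  proof (rule sum.cong)
    fix S assume S: "S \<in> sparse_subsets l e u c"
    then have "card S = u + c" using card_ev_od[OF fin[OF S], of l] by (simp add: sparse_subsets_def)
    then show "g (\<Sum>(ev l S) + \<Sum>(od l S)) = ?h (compress S)"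
      using sum_via_compress[OF fin[OF S], of l] by simp
  qed simp
  also have "\<dots> = (\<Sum>M\<in>msets l e u c. ?h M)"
    by (rule sum.reindex_bij_betw[OF bij_betw_compress])
  also have "\<dots> = (\<Sum>M\<in>msets l e u c. ?h (?\<rho> M))"
    by (rule sum.reindex_bij_betw[OF bij_betw_reflect_odd[OF assms], symmetric])
  also have "\<dots> = (\<Sum>M\<in>msets l e u c. ?h' M)"
  proof (rule sum.cong)
    fix M assume "M \<in> msets l e u c"
    then have "size (filter_mset (\<lambda>t. odd (t - l)) M) = c" by (simp add: msets_def)
    then have "?E (?\<rho> M) + ?O (?\<rho> M) + ?n * (?n - 1) =
        ?E M + (int c * (- 2 * (?n - 1)) - ?O M) + ?n * (?n - 1)"
      unfolding filter_reflect_odd[OF ev] sum_const_minus_mset by simp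
    \<comment> \<open>With n = u + c this is n(n - 1) - 2c(n - 1) = (n - 1)(u - c) = u(u - 1) - c(c
      - 1).\<close>
    also have "\<dots> = ?E M - ?O M + int u * (int u - 1) - int c * (int c - 1)"
      unfolding of_nat_add by (simp add: algebra_simps)
    finally show "?h (?\<rho> M) = ?h' M" by (rule arg_cong)
  qed simp
  also have "\<dots> = (\<Sum>S\<in>sparse_subsets l e u c. ?h' (compress S))"
    by (rule sum.reindex_bij_betw[OF bij_betw_compress, symmetric])
  also have "\<dots> = ?R"
  proof (rule sum.cong)
    fix S assume S: "S \<in> sparse_subsets l e u c"
    then show "?h' (compress S) = g (\<Sum>(ev l S) - \<Sum>(od l S) - 2 * (\<Sum>a\<in>ev l S. \<Sum>c\<in>od l S. sgn (a - c)))"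
      using signed_sum_via_compress[OF fin[OF S], of l] by (simp add: sparse_subsets_def)
  qed simp
  finally show ?thesis .
qed

section \<open>Matchings as sparse sets of tiles\<close>

text \<open>\<open>S\<close> is the set of tiles both of whose horizontal edges are matched.\<close>

definition matching_of :: "int \<Rightarrow> int \<Rightarrow> int set \<Rightarrow> edge set" where
  "matching_of l e S = Bot ` S \<union> Top ` S \<union> Vert ` {j \<in> {l..e + 1}. j \<notin> S \<and> j - 1 \<notin> S}"

lemma matching_of_iff [simp]:
  "Bot i \<in> matching_of l e S \<longleftrightarrow> i \<in> S"
  "Top i \<in> matching_of l e S \<longleftrightarrow> i \<in> S"
  "Vert i \<in> matching_of l e S \<longleftrightarrow> i \<in> {l..e + 1} \<and> i \<notin> S \<and> i - 1 \<notin> S"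
  by (auto simp: matching_of_def)

lemma tile_edges_iff [simp]:
  "Bot i \<in> tile_edges j \<longleftrightarrow> i = j"
  "Top i \<in> tile_edges j \<longleftrightarrow> i = j"
  "Vert i \<in> tile_edges j \<longleftrightarrow> i = j \<or> i = j + 1"
  by (auto simp: tile_edges_def)

lemma in_ends_iff:
  "(i, 0) \<in> ends x \<longleftrightarrow> x = Bot i \<or> x = Bot (i - 1) \<or> x = Vert i"
  "(i, 1) \<in> ends x \<longleftrightarrow> x = Top i \<or> x = Top (i - 1) \<or> x = Vert i"
  by (cases x; auto)+

lemma ex1_of_three:
  assumes "\<exists>!x. x \<in> P \<and> (x = a \<or> x = b \<or> x = c)" "a \<noteq> b" "a \<noteq> c" "b \<noteq> c"
  shows "(a \<in> P \<longleftrightarrow> b \<notin> P \<and> c \<notin> P) \<and> (b \<in> P \<longrightarrow> c \<notin> P)"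
  using assms by metis

lemma edge_set_eqI:
  assumes "\<And>i. Bot i \<in> P \<longleftrightarrow> Bot i \<in> Q" "\<And>i. Top i \<in> P \<longleftrightarrow> Top i \<in> Q" "\<And>i. Vert i \<in> P \<longleftrightarrow> Vert i \<in> Q"
  shows "P = Q"
  using assms by (metis edge.exhaust subsetI subset_antisym)

lemma inj_matching_of: "inj (matching_of l e)"
  by (rule injI) (metis matching_of_iff(1) subsetI subset_antisym)

text \<open>By sparseness neither neighbour of \<open>p\<close> is in S, so both vertical sides of
  \<open>p\<close> become free and are matched.\<close>

lemma twist_remove:
  assumes "S \<subseteq> {l..e}" "sparse S" "p \<in> S"
  shows "twist p (matching_of l e S) = matching_of l e (S - {p})"
proof -
  have "p + 1 \<notin> S" "p - 1 \<notin> S" "l \<le> p" "p \<le> e"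
    using assms unfolding sparse_def by (auto dest: bspec[of _ _ "p - 1"])
  then show ?thesis
    using assms(3) by (intro edge_set_eqI) (auto simp: twist_def)
qed

lemma twist_insert:
  assumes "p \<in> {l..e}" "p \<notin> S" "p - 1 \<notin> S" "p + 1 \<notin> S"
  shows "twist p (matching_of l e S) = matching_of l e (insert p S)"
  using assms by (intro edge_set_eqI) (auto simp: twist_def)

lemma card_Bot_Top:
  assumes "finite X"
  shows "card (Bot ` X \<union> Top ` X) = 2 * card X"
proof -
  have "card (Bot ` X \<union> Top ` X) = card (Bot ` X) + card (Top ` X)"
    using assms by (intro card_Un_disjoint) auto
  also have "\<dots> = 2 * card X"
    by (simp add: card_image inj_on_def)
  finally show ?thesis .
qed

section \<open>Counting and reflection in integer intervals\<close>

lemma sum_sgn: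
  fixes T :: "int set"
  assumes "finite T"
  shows "(\<Sum>c\<in>T. sgn (c - p)) = int (card {c \<in> T. p < c}) - int (card {c \<in> T. c < p})"
proof -
  have "(\<Sum>c\<in>T. sgn (c - p)) = (\<Sum>c\<in>T. of_bool (p < c)) - (\<Sum>c\<in>T. of_bool (c < p))"
    unfolding sum_subtractf[symmetric] by (intro sum.cong) (auto simp: sgn_if)
  then show ?thesis using assms by (simp add: sum_of_bool_eq Int_def)
qed

lemma card_same_parity_above:
  fixes p e :: int
  assumes "p \<le> e"
  shows "int (card {i \<in> {p<..e}. even (i - p)}) = (e - p) div 2"
proof -
  have "{i \<in> {p<..e}. even (i - p)} = (\<lambda>k. p + 2 * k) ` {1..(e - p) div 2}"
  proof (intro equalityI subsetI)
    fix i assume i: "i \<in> {i \<in> {p<..e}. even (i - p)}"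
    then obtain k where "i - p = 2 * k" unfolding mem_Collect_eq by (metis evenE)
    then show "i \<in> (\<lambda>k. p + 2 * k) ` {1..(e - p) div 2}"
      using i by (intro image_eqI[of _ _ k]) auto
  qed auto
  moreover have "inj_on (\<lambda>k. p + 2 * k) {1..(e - p) div 2}" by (auto simp: inj_on_def)
  ultimately show ?thesis using assms by (simp add: card_image)
qed

lemma card_same_parity_below:
  fixes p l :: int
  assumes "l \<le> p"
  shows "int (card {i \<in> {l..<p}. even (i - p)}) = (p - l) div 2"
proof -
  have "bij_betw uminus {i \<in> {l..<p}. even (i - p)} {i \<in> {- p<..- l}. even (i - - p)}"
    by (rule bij_betw_byWitness[of _ uminus]) auto
  then have "card {i \<in> {l..<p}. even (i - p)} = card {i \<in> {- p<..- l}. even (i - - p)}"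
    by (rule bij_betw_same_card)
  then show ?thesis using card_same_parity_above[of "- p" "- l"] assms by simp
qed

lemma sum_eq_0_if_reflected:
  fixes f :: "int \<Rightarrow> int"
  assumes "\<And>i. i \<in> X \<Longrightarrow> r - i \<in> X" "\<And>i. i \<in> X \<Longrightarrow> f (r - i) = - f i"
  shows "sum f X = 0"
proof -
  have "sum f X = (\<Sum>i\<in>X. f (r - i))"
    by (rule sum.reindex_bij_witness[of _ "\<lambda>i. r - i" "\<lambda>i. r - i"]) (auto simp: assms(1))
  also have "\<dots> = - sum f X"
    using assms(2) by (simp add: sum_negf)
  finally show ?thesis by simp
qed

text \<open>Treats both families at once: l + e is 0 for \<open>Gsnake\<close> and -1 for
  \<open>Hsnake\<close>, so \<open>i - l - e\<close> is \<open>i\<close> or \<open>i + 1\<close> as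
  the definition of alpha requires on weight 1.\<close>

locale snake_row =
  fixes G :: snake and l e :: int
  assumes leftmost_eq: "leftmost G = l"
    and tiles_eq: "tiles G = {l..e}"
    and nonempty: "l \<le> e"
    and right_end: "e = - l \<or> e = - l - 1"
    and alpha_tile_eq: "alpha_tile G i = (if weight G i = 1 then i - l - e else - i)"
begin

lemma weight_eq: "weight G i = (if even (i - l) then 1 else 2)"
  by (simp add: weight_def leftmost_eq)

lemma edges_iff [simp]:
  "Bot i \<in> edges G \<longleftrightarrow> i \<in> {l..e}"
  "Top i \<in> edges G \<longleftrightarrow> i \<in> {l..e}"
  "Vert i \<in> edges G \<longleftrightarrow> i \<in> {l..e + 1}"
proof -
  show "Vert i \<in> edges G \<longleftrightarrow> i \<in> {l..e + 1}"
  proof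
    assume "i \<in> {l..e + 1}"
    then have "i \<in> {l..e} \<or> i - 1 \<in> {l..e}" using nonempty by auto
    then show "Vert i \<in> edges G" unfolding edges_def tiles_eq by fastforce
  qed (auto simp: edges_def tiles_eq)
qed (auto simp: edges_def tiles_eq)

lemma boundary_edges_iff [simp]:
  "Bot i \<in> boundary_edges G \<longleftrightarrow> i \<in> {l..e}"
  "Top i \<in> boundary_edges G \<longleftrightarrow> i \<in> {l..e}"
  "Vert i \<in> boundary_edges G \<longleftrightarrow> i = l \<or> i = e + 1"
proof -
  have "\<not> (\<exists>!j. j \<in> {l..e} \<and> (i = j \<or> i = j + 1))" if "l < i" "i \<le> e"
  proof
    assume "\<exists>!j. j \<in> {l..e} \<and> (i = j \<or> i = j + 1)"
    moreover have "i \<in> {l..e}" "i - 1 \<in> {l..e}" using that by auto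
    ultimately have "i = i - 1" by (metis diff_add_cancel)
    then show False by simp
  qed
  moreover have "\<exists>!j. j \<in> {l..e} \<and> (i = j \<or> i = j + 1)" if "i = l \<or> i = e + 1"
    using that
  proof
    assume "i = l"
    then show ?thesis using nonempty by (intro ex1I[of _ l]) auto
  next
    assume "i = e + 1"
    then show ?thesis using nonempty by (intro ex1I[of _ e]) auto
  qed
  moreover have "Vert i \<in> boundary_edges G \<longleftrightarrow>
      l \<le> i \<and> i \<le> e + 1 \<and> (\<exists>!j. j \<in> {l..e} \<and> (i = j \<or> i = j + 1))"
    unfolding boundary_edges_def tiles_eq mem_Collect_eq tile_edges_iff edges_iff atLeastAtMost_iff by blast
  ultimately show "Vert i \<in> boundary_edges G \<longleftrightarrow> i = l \<or> i = e + 1"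
    using nonempty by (cases "i = l \<or> i = e + 1") auto
qed (auto simp: boundary_edges_def tiles_eq)

lemma vertices_eq: "vertices G = {l..e + 1} \<times> {0, 1}"
proof (intro equalityI subsetI)
  fix x assume "x \<in> vertices G"
  then obtain y where "y \<in> edges G" "x \<in> ends y" by (auto simp: vertices_def)
  then show "x \<in> {l..e + 1} \<times> {0, 1}" by (cases y) auto
next
  fix x :: "int \<times> int" assume x: "x \<in> {l..e + 1} \<times> {0, 1}"
  then have "Vert (fst x) \<in> edges G" "x \<in> ends (Vert (fst x))" by (auto simp: prod_eq_iff)
  then show "x \<in> vertices G" unfolding vertices_def by blast
qed

section \<open>Perfect matchings of a row\<close>

lemma matchings_iff:
  "P \<in> matchings G \<longleftrightarrow> P \<subseteq> edges G \<and> (\<forall>i\<in>{l..e + 1}.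
     (\<exists>!x. x \<in> P \<and> (x = Bot i \<or> x = Bot (i - 1) \<or> x = Vert i)) \<and>
     (\<exists>!x. x \<in> P \<and> (x = Top i \<or> x = Top (i - 1) \<or> x = Vert i)))"
  unfolding matchings_def vertices_eq by (auto simp: in_ends_iff)

lemma matching_of_in_matchings:
  assumes "S \<subseteq> {l..e}" "sparse S"
  shows "matching_of l e S \<in> matchings G"
proof -
  have "x \<in> edges G" if "x \<in> matching_of l e S" for x
    using that assms(1) by (cases x) auto
  moreover have "(\<exists>!x. x \<in> matching_of l e S \<and> (x = Bot i \<or> x = Bot (i - 1) \<or> x = Vert i)) \<and>
     (\<exists>!x. x \<in> matching_of l e S \<and> (x = Top i \<or> x = Top (i - 1) \<or> x = Vert i))"
    if i: "i \<in> {l..e + 1}" for i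
  proof -
    \<comment> \<open>Both vertices of column \<open>i\<close> are covered by tile \<open>i\<close>,
      by tile \<open>i - 1\<close>, or by the vertical edge between them; sparseness excludes a
      double cover.\<close>
    consider "i \<in> S" "i - 1 \<notin> S" | "i \<notin> S" "i - 1 \<in> S" | "i \<notin> S" "i - 1 \<notin> S"
      using assms(2) unfolding sparse_def by force
    then show ?thesis
    proof cases
      case 1
      then show ?thesis by (intro conjI ex1I[of _ "Bot i"] ex1I[of _ "Top i"]) auto
    next
      case 2
      then show ?thesis by (intro conjI ex1I[of _ "Bot (i - 1)"] ex1I[of _ "Top (i - 1)"]) auto
    next
      case 3
      then show ?thesis using i by (intro conjI ex1I[of _ "Vert i"]) auto
    qed
  qed
  ultimately show ?thesis unfolding matchings_iff by (intro conjI ballI subsetI) simp_all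
qed

text \<open>The top and bottom vertices of a column share their vertical edge, so bottom and top
  edges are forced in parallel from left to right. The tiles with a matched bottom edge then
  determine everything.\<close>

lemma matchings_eq: "matchings G = matching_of l e ` {S. S \<subseteq> {l..e} \<and> sparse S}"
proof (intro equalityI subsetI)
  fix P assume "P \<in> matchings G"
  then have sub: "P \<subseteq> edges G"
    and bot: "\<And>i. i \<in> {l..e + 1} \<Longrightarrow> \<exists>!x. x \<in> P \<and> (x = Bot i \<or> x = Bot (i - 1) \<or> x = Vert i)"
    and top: "\<And>i. i \<in> {l..e + 1} \<Longrightarrow> \<exists>!x. x \<in> P \<and> (x = Top i \<or> x = Top (i - 1) \<or> x = Vert i)"
    unfolding matchings_iff by blast+
  have out: "Bot i \<notin> P" "Top i \<notin> P" if "i \<notin> {l..e}" for i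
    using that sub edges_iff by blast+
  have out': "Vert i \<notin> P" if "i \<notin> {l..e + 1}" for i
    using that sub edges_iff by blast
  have bot': "Bot i \<in> P \<longleftrightarrow> Bot (i - 1) \<notin> P \<and> Vert i \<notin> P"
    "Bot (i - 1) \<in> P \<Longrightarrow> Vert i \<notin> P" if "i \<in> {l..e + 1}" for i
    using ex1_of_three[OF bot[OF that]] by auto
  have top': "Top i \<in> P \<longleftrightarrow> Top (i - 1) \<notin> P \<and> Vert i \<notin> P" if "i \<in> {l..e + 1}" for i
    using ex1_of_three[OF top[OF that]] by auto
  \<comment> \<open>The induction starts one column before the row, where neither edge
    exists.\<close>
  have "i \<le> e + 1 \<longrightarrow> (Bot i \<in> P \<longleftrightarrow> Top i \<in> P)" if "l - 1 \<le> i" for i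
    using that
  proof (induction i rule: int_ge_induct)
    case base
    then show ?case using out[of "l - 1"] by simp
  next
    case (step i)
    show ?case
    proof
      assume "i + 1 \<le> e + 1"
      then have "i + 1 \<in> {l..e + 1}" using step by auto
      then show "Bot (i + 1) \<in> P \<longleftrightarrow> Top (i + 1) \<in> P"
        using step bot'(1)[of "i + 1"] top'[of "i + 1"] by simp
    qed
  qed
  then have bt: "Bot i \<in> P \<longleftrightarrow> Top i \<in> P" for i
    using out[of i] by (cases "i \<in> {l..e}") auto
  define S where "S = {i. Bot i \<in> P}"
  have S: "S \<subseteq> {l..e}" using out(1) unfolding S_def by blast
  have "sparse S"
    unfolding sparse_def
  proof
    fix i assume "i \<in> S"
    then have "i \<in> {l..e}" "Bot i \<in> P" using S by (blast, simp add: S_def)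
    moreover from this(1) have "i + 1 \<in> {l..e + 1}" by simp
    ultimately show "i + 1 \<notin> S" using bot'(1)[of "i + 1"] by (simp add: S_def)
  qed
  moreover have "P = matching_of l e S"
  proof (rule edge_set_eqI)
    fix i
    show "Vert i \<in> P \<longleftrightarrow> Vert i \<in> matching_of l e S"
    proof (cases "i \<in> {l..e + 1}")
      case True
      then show ?thesis using bot'[OF True] by (auto simp: S_def)
    next
      case False
      then show ?thesis using out'[OF False] False by auto
    qed
  qed (simp_all add: S_def bt)
  ultimately show "P \<in> matching_of l e ` {S. S \<subseteq> {l..e} \<and> sparse S}" using S by blast
next
  fix P assume "P \<in> matching_of l e ` {S. S \<subseteq> {l..e} \<and> sparse S}"
  then show "P \<in> matchings G" using matching_of_in_matchings by blast
qed

section \<open>Boundary matchings and enclosed tiles\<close>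

lemma sparse_ev_od: "sparse (ev l {l..e})" "sparse (od l {l..e})"
  by (auto simp: sparse_def ev_def od_def)

lemma sub_ev_od: "ev l {l..e} \<subseteq> {l..e}" "od l {l..e} \<subseteq> {l..e}"
  by (auto simp: ev_def od_def)

text \<open>Without inner vertical edges one of any two neighbouring tiles lies in S, and by
  sparseness only one. Membership therefore alternates and is fixed by the leftmost tile.\<close>

lemma boundary_matching_cases:
  assumes "S \<subseteq> {l..e}" "sparse S" "matching_of l e S \<subseteq> boundary_edges G"
  shows "S = (if l \<in> S then ev l {l..e} else od l {l..e})"
proof -
  have "i \<le> e \<longrightarrow> (i \<in> S \<longleftrightarrow> (l \<in> S \<longleftrightarrow> even (i - l)))" if "l \<le> i" for i
    using that
  proof (induction i rule: int_ge_induct)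
    case base
    then show ?case by simp
  next
    case (step i)
    show ?case
    proof
      assume i: "i + 1 \<le> e"
      then have "Vert (i + 1) \<notin> boundary_edges G" using step by simp
      then have "Vert (i + 1) \<notin> matching_of l e S" using assms(3) by blast
      then have "i + 1 \<in> S \<or> i \<in> S" using step i by simp
      then have "i + 1 \<in> S \<longleftrightarrow> i \<notin> S" using assms(2) by (auto simp: sparse_def)
      then show "i + 1 \<in> S \<longleftrightarrow> (l \<in> S \<longleftrightarrow> even (i + 1 - l))" using step i by auto
    qed
  qed
  then show ?thesis using assms(1) by (auto simp: ev_def od_def)
qed

lemma boundary_ev_od:
  "matching_of l e (ev l {l..e}) \<subseteq> boundary_edges G"
  "matching_of l e (od l {l..e}) \<subseteq> boundary_edges G"
proof -
  have alt: "i = l \<or> i = e + 1" if "i \<in> {l..e + 1}" "i \<notin> X" "i - 1 \<notin> X"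
    and X: "X = ev l {l..e} \<or> X = od l {l..e}" for i X
  proof (rule ccontr)
    assume "\<not> (i = l \<or> i = e + 1)"
    then have "i \<in> {l..e}" "i - 1 \<in> {l..e}" using that(1) by auto
    then have "even (i - l) \<and> even (i - 1 - l) \<or> odd (i - l) \<and> odd (i - 1 - l)"
      using that(2,3) X unfolding ev_def od_def by blast
    then show False by presburger
  qed
  have "matching_of l e X \<subseteq> boundary_edges G" if X: "X = ev l {l..e} \<or> X = od l {l..e}" for X
  proof
    fix x assume x: "x \<in> matching_of l e X"
    have "X \<subseteq> {l..e}" using X sub_ev_od by blast
    then show "x \<in> boundary_edges G"
      using x alt[OF _ _ _ X] unfolding matching_of_def by force
  qed
  then show "matching_of l e (ev l {l..e}) \<subseteq> boundary_edges G"
    "matching_of l e (od l {l..e}) \<subseteq> boundary_edges G" by blast+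
qed

lemma P_min_eq: "P_min G = matching_of l e (od l {l..e})"
  unfolding P_min_def
proof (rule the_equality)
  show "matching_of l e (od l {l..e}) \<in> matchings G \<and>
      matching_of l e (od l {l..e}) \<subseteq> boundary_edges G \<and>
      Vert (leftmost G) \<in> matching_of l e (od l {l..e})"
    unfolding leftmost_eq
    using matching_of_in_matchings[OF sub_ev_od(2) sparse_ev_od(2)] boundary_ev_od(2) nonempty
    by (intro conjI) (assumption+, simp add: od_def)
next
  fix P assume P: "P \<in> matchings G \<and> P \<subseteq> boundary_edges G \<and> Vert (leftmost G) \<in> P"
  then obtain S where S: "S \<subseteq> {l..e}" "sparse S" "P = matching_of l e S"
    by (auto simp: matchings_eq)
  then have "l \<notin> S" using P by (auto simp: leftmost_eq)
  then show "P = matching_of l e (od l {l..e})"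
    using boundary_matching_cases[OF S(1,2)] P S(3) by simp
qed

lemma P_max_eq: "P_max G = matching_of l e (ev l {l..e})"
  unfolding P_max_def P_min_eq
proof (rule the_equality)
  have "l \<in> ev l {l..e}" "l \<notin> od l {l..e}" using nonempty by (auto simp: ev_def od_def)
  then have "matching_of l e (ev l {l..e}) \<noteq> matching_of l e (od l {l..e})"
    using injD[OF inj_matching_of] by blast
  then show "matching_of l e (ev l {l..e}) \<in> matchings G \<and>
      matching_of l e (ev l {l..e}) \<subseteq> boundary_edges G \<and>
      matching_of l e (ev l {l..e}) \<noteq> matching_of l e (od l {l..e})"
    using matching_of_in_matchings[OF sub_ev_od(1) sparse_ev_od(1)] boundary_ev_od(1) by blast
next
  fix P assume P: "P \<in> matchings G \<and> P \<subseteq> boundary_edges G \<and> P \<noteq> matching_of l e (od l {l..e})"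
  then obtain S where S: "S \<subseteq> {l..e}" "sparse S" "P = matching_of l e S"
    by (auto simp: matchings_eq)
  then show "P = matching_of l e (ev l {l..e})"
    using boundary_matching_cases[OF S(1,2)] P by metis
qed

text \<open>A tile is enclosed exactly when its horizontal edges lie in the symmetric difference,
  that is when S and the weight 2 tiles disagree on it. Any other tile can be left through its
  bottom edge.\<close>

lemma Twist_eq:
  assumes "S \<subseteq> {l..e}" "sparse S"
  shows "Twist G (matching_of l e S) = {i \<in> {l..e}. i \<in> S \<longleftrightarrow> even (i - l)}"
proof -
  define D where "D = sym_diff (matching_of l e S) (P_min G)"
  define T where "T = {i \<in> {l..e}. i \<in> S \<longleftrightarrow> even (i - l)}"
  have D: "Bot i \<in> D \<longleftrightarrow> i \<in> T" "Top i \<in> D \<longleftrightarrow> i \<in> T" for i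
    using assms(1) by (auto simp: D_def T_def P_min_eq od_def)
  \<comment> \<open>\<open>P_min G\<close> has the vertical edge at the left end, the one at the
    right end if the last tile has weight 1, and no other.\<close>
  have V: "Vert i \<in> D \<longleftrightarrow> i \<in> {l..e + 1} \<and>
      (i \<notin> S \<and> i - 1 \<notin> S \<longleftrightarrow> \<not> (i = l \<or> i = e + 1 \<and> even (e - l)))" for i
  proof (cases "i \<in> {l..e + 1}")
    case True
    have "i \<notin> od l {l..e} \<and> i - 1 \<notin> od l {l..e} \<longleftrightarrow> i = l \<or> i = e + 1 \<and> even (e - l)"
    proof (cases "i = l \<or> i = e + 1")
      case True
      then show ?thesis using nonempty by (auto simp: od_def)
    next
      case False
      then have "i \<in> {l..e}" "i - 1 \<in> {l..e}" using \<open>i \<in> {l..e + 1}\<close> by auto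
      moreover have "odd (i - l) \<or> odd (i - 1 - l)" by presburger
      ultimately show ?thesis using False unfolding od_def by blast
    qed
    then show ?thesis using True by (auto simp: D_def P_min_eq)
  next
    case False
    then show ?thesis by (auto simp: D_def P_min_eq)
  qed
  have no: "i + 1 \<notin> S" "i - 1 \<notin> S" if "i \<in> S" for i
    using assms(2) that unfolding sparse_def by (auto dest: bspec[of _ _ "i - 1"])
  have "outside G D = {l..e} - T"
  proof (intro equalityI subsetI)
    fix i assume "i \<in> outside G D"
    then show "i \<in> {l..e} - T"
    proof induction
      case (exit i x)
      then have i: "i \<in> {l..e}" by (simp add: tiles_eq)
      have "i \<notin> T"
      proof
        assume T: "i \<in> T"
        consider "x = Bot i" | "x = Top i" | "x = Vert l" "i = l" | "x = Vert (e + 1)" "i = e"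
          using exit i by (cases x) auto
        then show False
        proof cases
          case 3
          then show False using exit(4) T no[of l] nonempty by (auto simp: V T_def)
        next
          case 4
          then show False using exit(4) T assms(1) nonempty by (auto simp: V T_def)
        qed (use exit(4) T D in auto)
      qed
      then show ?case using i by simp
    next
      case (cross j i x)
      then have i: "i \<in> {l..e}" by (simp add: tiles_eq)
      have "i \<notin> T"
      proof
        assume T: "i \<in> T"
        then have "i \<noteq> j" using cross by blast
        \<comment> \<open>Neighbours have opposite parity, so if just one of them is in
          \<open>T\<close>, both or neither are in S. Sparseness leaves neither; then their common
          edge is matched and lies in \<open>D\<close>.\<close>
        then obtain k where k: "x = Vert k" "i = k \<and> j = k - 1 \<or> i = k - 1 \<and> j = k"
          using cross by (cases x) auto
        show False
          using k(2) T i cross.IH \<open>x \<notin> D\<close> no[of i] unfolding k(1) V T_def by auto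
      qed
      then show ?case using i by simp
    qed
  next
    fix i assume "i \<in> {l..e} - T"
    then show "i \<in> outside G D"
      using D by (intro outside.exit[of _ _ "Bot i"]) (auto simp: tiles_eq)
  qed
  moreover have "T \<subseteq> {l..e}" unfolding T_def by blast
  ultimately have "Twist G (matching_of l e S) = T"
    unfolding Twist_def D_def[symmetric] tiles_eq by (simp add: double_diff)
  then show ?thesis unfolding T_def .
qed

section \<open>The maps alpha and v on sparse sets\<close>

lemma finite_sub: "S \<subseteq> {l..e} \<Longrightarrow> finite S"
  using finite_subset by blast

text \<open>The map i -> -i permutes the weight 2 tiles, also for \<open>Hsnake\<close>, where the
  last tile has weight 2.\<close>

lemma sum_od_row: "\<Sum>(od l {l..e}) = 0"
proof (rule sum_eq_0_if_reflected[of _ 0])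
  fix i assume i: "i \<in> od l {l..e}"
  then have "i \<noteq> l" by (auto simp: od_def)
  moreover have "odd (0 - i - l)" using i unfolding od_def by simp
  ultimately show "0 - i \<in> od l {l..e}" using i right_end unfolding od_def by auto
qed simp

lemma sum_ev_row: "(\<Sum>i\<in>ev l {l..e}. i - l - e) = 0"
proof (rule sum_eq_0_if_reflected[of _ "2 * (l + e)"])
  fix i assume i: "i \<in> ev l {l..e}"
  have "even (e - l) \<longleftrightarrow> e = - l" using right_end by auto
  then have "i \<noteq> e" if "e = - l - 1" using i that by (auto simp: ev_def)
  then have "2 * (l + e) - i \<in> {l..e}" using i right_end by (auto simp: ev_def)
  moreover have "even (2 * (l + e) - i - l)" using i unfolding ev_def by simp
  ultimately show "2 * (l + e) - i \<in> ev l {l..e}" unfolding ev_def by simp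
qed simp

lemma Twist_eq_Un:
  assumes "S \<subseteq> {l..e}" "sparse S"
  shows "Twist G (matching_of l e S) = ev l S \<union> (od l {l..e} - od l S)"
  using assms unfolding Twist_eq[OF assms] ev_def od_def by auto

text \<open>The enclosed weight 2 tiles are those missing from S. As all weight 2 positions sum to
  0, the negated sum over the missing ones is the sum over those present.\<close>

lemma alpha_eq:
  assumes "S \<subseteq> {l..e}" "sparse S"
  shows "alpha G (matching_of l e S) = \<Sum>(ev l S) + \<Sum>(od l S) - int (card (ev l S)) * (l + e)"
proof -
  have fin: "finite S" using finite_sub assms(1) .
  have sub: "od l S \<subseteq> od l {l..e}" using assms(1) by (auto simp: od_def)
  have "alpha G (matching_of l e S) = (\<Sum>i\<in>ev l S. alpha_tile G i) + (\<Sum>i\<in>od l {l..e} - od l S. alpha_tile G i)"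
    unfolding alpha_def Twist_eq_Un[OF assms]
    by (intro sum.union_disjoint finite_ev_od finite_Diff) (auto simp: ev_def od_def fin)
  also have "(\<Sum>i\<in>ev l S. alpha_tile G i) = (\<Sum>i\<in>ev l S. i - (l + e))"
    by (intro sum.cong) (auto simp: alpha_tile_eq weight_eq ev_def)
  also have "\<dots> = \<Sum>(ev l S) - int (card (ev l S)) * (l + e)"
    by (simp add: sum_subtractf)
  also have "(\<Sum>i\<in>od l {l..e} - od l S. alpha_tile G i) = (\<Sum>i\<in>od l {l..e} - od l S. - i)"
    by (intro sum.cong) (auto simp: alpha_tile_eq weight_eq od_def)
  also have "\<dots> = \<Sum>(od l S)"
    using sub sum_od_row by (simp add: sum_negf sum_diff)
  finally show ?thesis by simp
qed

text \<open>The second claim ensures that the natural subtraction does not truncate, so that dim P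
  determines the sizes of both parts of S.\<close>

lemma dimP_eq:
  assumes "S \<subseteq> {l..e}" "sparse S"
  shows "dimP G (matching_of l e S) = (card (ev l S), card (od l {l..e}) - card (od l S))"
    and "card (od l S) \<le> card (od l {l..e})"
proof -
  have sub: "od l S \<subseteq> od l {l..e}" using assms(1) by (auto simp: od_def)
  show "card (od l S) \<le> card (od l {l..e})" using sub by (simp add: card_mono)
  have "{i \<in> Twist G (matching_of l e S). weight G i = 1} = ev l S"
    "{i \<in> Twist G (matching_of l e S). weight G i = 2} = od l {l..e} - od l S"
    unfolding Twist_eq_Un[OF assms] by (auto simp: weight_eq ev_def od_def)
  then show "dimP G (matching_of l e S) = (card (ev l S), card (od l {l..e}) - card (od l S))"
    unfolding dimP_def using sub finite_sub[OF assms(1)] by (simp add: card_Diff_subset)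
qed

section \<open>Edge labels, twist relations and the closed form of v\<close>

lemma labelled_edges:
  assumes "k = 1 \<or> k = 2"
  shows "{x \<in> matching_of l e S. edge_label G x = Some k} =
    Bot ` {i \<in> S. weight G i \<noteq> k} \<union> Top ` {i \<in> S. weight G i \<noteq> k}"
proof (rule edge_set_eqI)
  fix i
  show "Bot i \<in> {x \<in> matching_of l e S. edge_label G x = Some k} \<longleftrightarrow>
      Bot i \<in> Bot ` {i \<in> S. weight G i \<noteq> k} \<union> Top ` {i \<in> S. weight G i \<noteq> k}"
    using assms by (auto simp: weight_eq)
  show "Top i \<in> {x \<in> matching_of l e S. edge_label G x = Some k} \<longleftrightarrow>
      Top i \<in> Bot ` {i \<in> S. weight G i \<noteq> k} \<union> Top ` {i \<in> S. weight G i \<noteq> k}"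
    using assms by (auto simp: weight_eq)
qed auto

lemma num_edges_eq:
  assumes "finite S" "k = 1 \<or> k = 2"
  shows "num_edges G k R (matching_of l e S) = 2 * int (card {i \<in> S. i \<in> R \<and> weight G i \<noteq> k})"
proof -
  let ?X = "{i \<in> S. i \<in> R \<and> weight G i \<noteq> k}"
  have "{x \<in> matching_of l e S. edge_label G x = Some k \<and> (\<exists>i\<in>R. x \<in> tile_edges i)} =
    {x \<in> {x \<in> matching_of l e S. edge_label G x = Some k}. \<exists>i\<in>R. x \<in> tile_edges i}" by blast
  also have "\<dots> = Bot ` ?X \<union> Top ` ?X" unfolding labelled_edges[OF assms(2)] by auto
  finally show ?thesis using assms(1) by (simp add: num_edges_def card_Bot_Top)
qed

lemma a_vec_eq:
  assumes "finite S"
  shows "a_vec G (matching_of l e S) =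
    (2 * int (card (od l S)) - int (card (ev l {l..e})),
     2 * int (card (ev l S)) - int (card (od l {l..e})))"
proof -
  have "{i \<in> S. weight G i \<noteq> 1} = od l S" "{i \<in> S. weight G i \<noteq> 2} = ev l S"
    "{i \<in> {l..e}. weight G i = 1} = ev l {l..e}" "{i \<in> {l..e}. weight G i = 2} = od l {l..e}"
    by (auto simp: weight_eq ev_def od_def)
  moreover have "{x \<in> matching_of l e S. edge_label G x = Some 1} =
      Bot ` {i \<in> S. weight G i \<noteq> 1} \<union> Top ` {i \<in> S. weight G i \<noteq> 1}"
    "{x \<in> matching_of l e S. edge_label G x = Some 2} =
      Bot ` {i \<in> S. weight G i \<noteq> 2} \<union> Top ` {i \<in> S. weight G i \<noteq> 2}"
    by (intro labelled_edges; simp)+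
  ultimately show ?thesis
    unfolding a_vec_def tiles_eq using assms by (simp add: card_Bot_Top)
qed

text \<open>The value \<open>n\<^sup>+ - m\<^sup>+ - n\<^sup>- + m\<^sup>-\<close> at the tile \<open>p\<close>; the first two
  summands are \<open>m\<^sup>- - m\<^sup>+\<close>, since \<open>l + e\<close> is 0 for \<open>Gsnake\<close> and -1 for \<open>Hsnake\<close>.\<close>

definition excess :: "int \<Rightarrow> int set \<Rightarrow> int" where
  "excess p S = p - (if even (p - l) then l + e else 0)
    + 2 * int (card {i \<in> S. odd (i - p) \<and> p < i}) - 2 * int (card {i \<in> S. odd (i - p) \<and> i < p})"

lemma Omega_eq:
  assumes "S \<subseteq> {l..e}" "sparse S" "p \<in> {l..e}"
  shows "Omega G p (matching_of l e S) =
    (if p \<in> S \<longleftrightarrow> even (p - l) then excess p S else - excess p S)"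
proof -
  define R where "R = {i \<in> {l..e}. p < i}"
  define L where "L = {i \<in> {l..e}. i < p}"
  define k where "k = weight G p"
  have k: "k = 1 \<or> k = 2" by (simp add: k_def weight_eq)
  have w: "weight G i = k \<longleftrightarrow> even (i - p)" for i
    by (auto simp: k_def weight_eq)
  have "{i \<in> S. i \<in> R \<and> weight G i \<noteq> k} = {i \<in> S. odd (i - p) \<and> p < i}"
    "{i \<in> S. i \<in> L \<and> weight G i \<noteq> k} = {i \<in> S. odd (i - p) \<and> i < p}"
    using assms(1) unfolding w R_def L_def by auto
  then have n: "num_edges G k R (matching_of l e S) = 2 * int (card {i \<in> S. odd (i - p) \<and> p < i})"
    "num_edges G k L (matching_of l e S) = 2 * int (card {i \<in> S. odd (i - p) \<and> i < p})"
    by (simp_all only: num_edges_eq[OF finite_sub[OF assms(1)] k])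
  have "{i \<in> R. even (i - p)} = {i \<in> {p<..e}. even (i - p)}"
    "{i \<in> L. even (i - p)} = {i \<in> {l..<p}. even (i - p)}"
    using assms(3) unfolding R_def L_def by auto
  then have m: "num_tiles G k R = (e - p) div 2" "num_tiles G k L = (p - l) div 2"
    unfolding num_tiles_def w
    using assms(3) by (simp_all only: card_same_parity_above card_same_parity_below atLeastAtMost_iff)
  \<comment> \<open>If \<open>e = - l\<close>, the two divisions round equally and the difference is
    \<open>p\<close>. If \<open>e = - l - 1\<close>, just one of them rounds down, which adds 1 for
    even \<open>p - l\<close>.\<close>
  have "(p - l) div 2 - (e - p) div 2 = p - (if even (p - l) then l + e else 0)"
    using right_end by (elim disjE; clarify; presburger)
  then have d: "num_edges G k R (matching_of l e S) - num_tiles G k R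
      - num_edges G k L (matching_of l e S) + num_tiles G k L = excess p S"
    unfolding n m excess_def by simp
  have "p \<in> Twist G (matching_of l e S) \<longleftrightarrow> (p \<in> S \<longleftrightarrow> even (p - l))"
    using assms(3) unfolding Twist_eq[OF assms(1,2)] by blast
  then show ?thesis
    unfolding Omega_def Let_def tiles_eq k_def[symmetric] R_def[symmetric] L_def[symmetric] d by simp
qed

text \<open>The closed form of v. The term with \<open>l + e\<close> is the same as in
  \<open>alpha_eq\<close> and is constant on each dimension class.\<close>

definition potential :: "int set \<Rightarrow> int" where
  "potential S = \<Sum>(ev l S) - \<Sum>(od l S) - int (card (ev l S)) * (l + e)
     - 2 * (\<Sum>a\<in>ev l S. \<Sum>c\<in>od l S. sgn (a - c))"

text \<open>Only terms involving \<open>p\<close> survive in the difference: its position and its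
  sgn sum against the tiles of the other parity, which counts those above minus those below.\<close>

lemma potential_remove:
  assumes "finite S" "p \<in> S"
  shows "potential S - potential (S - {p}) = (if even (p - l) then excess p S else - excess p S)"
proof -
  define T where "T = S - {p}"
  have T: "S = insert p T" "p \<notin> T" "finite T" "T - {p} = T" using assms by (auto simp: T_def)
  have fin: "finite (ev l T)" "finite (od l T)" using T by simp_all
  have o: "{i \<in> insert p T. odd (i - p) \<and> p < i} = {i \<in> T. odd (i - p) \<and> p < i}"
    "{i \<in> insert p T. odd (i - p) \<and> i < p} = {i \<in> T. odd (i - p) \<and> i < p}" by auto
  show ?thesis
  proof (cases "even (p - l)")
    case True
    then have e: "ev l (insert p T) = insert p (ev l T)" "od l (insert p T) = od l T" "p \<notin> ev l T"
      using T(2) unfolding ev_def od_def by auto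
    have "odd (i - p) \<longleftrightarrow> odd (i - l)" for i using True by presburger
    then have "{i \<in> T. odd (i - p) \<and> p < i} = {c \<in> od l T. p < c}"
      "{i \<in> T. odd (i - p) \<and> i < p} = {c \<in> od l T. c < p}"
      unfolding od_def by auto
    moreover have "(\<Sum>c\<in>od l T. sgn (p - c)) = - (\<Sum>c\<in>od l T. sgn (c - p))"
      unfolding sum_negf[symmetric] by (intro sum.cong) (auto simp: sgn_if)
    ultimately show ?thesis
      using True fin e T(4) sum_sgn[OF fin(2), of p]
      unfolding T_def[symmetric] T(1) potential_def excess_def o by (simp add: algebra_simps)
  next
    case False
    then have e: "ev l (insert p T) = ev l T" "od l (insert p T) = insert p (od l T)" "p \<notin> od l T"
      using T(2) unfolding ev_def od_def by auto
    have "odd (i - p) \<longleftrightarrow> even (i - l)" for i using False by presburger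
    then have "{i \<in> T. odd (i - p) \<and> p < i} = {c \<in> ev l T. p < c}"
      "{i \<in> T. odd (i - p) \<and> i < p} = {c \<in> ev l T. c < p}"
      unfolding ev_def by auto
    then show ?thesis
      using False fin e T(4) sum_sgn[OF fin(1), of p]
      unfolding T_def[symmetric] T(1) potential_def excess_def o by (simp add: sum.distrib algebra_simps)
  qed
qed

text \<open>If \<open>p\<close> is not in S, the two matched edges of its tile must be its vertical
  sides, so neither neighbour is in S.\<close>

lemma can_twist_cases:
  assumes "S \<subseteq> {l..e}" "sparse S" "can_twist G (matching_of l e S) p"
  obtains "p \<in> S" | "p \<in> {l..e}" "p \<notin> S" "p - 1 \<notin> S" "p + 1 \<notin> S"
proof (cases "p \<in> S")
  case False
  have p: "p \<in> {l..e}" and card: "card (tile_edges p \<inter> matching_of l e S) = 2"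
    using assms(3) by (auto simp: can_twist_def tiles_eq)
  have "tile_edges p \<inter> matching_of l e S \<subseteq> {Vert p, Vert (p + 1)}"
    using False unfolding tile_edges_def by auto
  then have "tile_edges p \<inter> matching_of l e S = {Vert p, Vert (p + 1)}"
    using card by (intro card_subset_eq) auto
  then have "Vert p \<in> matching_of l e S" "Vert (p + 1) \<in> matching_of l e S" by blast+
  then have "p - 1 \<notin> S" "p + 1 \<notin> S" by simp_all
  with p False that show ?thesis by blast
qed (use that in blast)

lemma can_twist_if_mem:
  assumes "S \<subseteq> {l..e}" "sparse S" "p \<in> S"
  shows "can_twist G (matching_of l e S) p"
proof -
  have "p + 1 \<notin> S" using assms unfolding sparse_def by blast
  then have "tile_edges p \<inter> matching_of l e S = {Bot p, Top p}"
    using assms(3) unfolding tile_edges_def by auto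
  then show ?thesis using assms by (auto simp: can_twist_def tiles_eq)
qed

text \<open>The excess at \<open>p\<close> sees only tiles of the other parity, so adding or
  removing \<open>p\<close> itself does not change it; the relation thus holds in both
  directions.\<close>

lemma potential_twist:
  assumes "S \<subseteq> {l..e}" "sparse S" "p \<in> S"
  shows "potential S - potential (S - {p}) = Omega G p (matching_of l e S)"
    and "potential (S - {p}) - potential S = Omega G p (matching_of l e (S - {p}))"
proof -
  have p: "p \<in> {l..e}" and S': "S - {p} \<subseteq> {l..e}" "sparse (S - {p})"
    using assms sparse_subset[OF assms(2)] by auto
  have "{i \<in> S - {p}. odd (i - p) \<and> p < i} = {i \<in> S. odd (i - p) \<and> p < i}"
    "{i \<in> S - {p}. odd (i - p) \<and> i < p} = {i \<in> S. odd (i - p) \<and> i < p}" by auto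
  then have "excess p (S - {p}) = excess p S" unfolding excess_def by simp
  then show "potential S - potential (S - {p}) = Omega G p (matching_of l e S)"
    "potential (S - {p}) - potential S = Omega G p (matching_of l e (S - {p}))"
    using potential_remove[OF finite_sub[OF assms(1)] assms(3)] assms(3)
    unfolding Omega_eq[OF assms(1,2) p] Omega_eq[OF S' p] by (auto split: if_splits)
qed

section \<open>Existence and uniqueness of v\<close>

definition v_explicit :: "edge set \<Rightarrow> int" where
  "v_explicit P = (if P \<in> matchings G then potential {i. Bot i \<in> P} else 0)"

lemma v_explicit_matching_of:
  assumes "S \<subseteq> {l..e}" "sparse S"
  shows "v_explicit (matching_of l e S) = potential S"
  using matching_of_in_matchings[OF assms] by (simp add: v_explicit_def)

lemma is_v_explicit: "is_v G v_explicit"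
  unfolding is_v_def
proof (intro conjI ballI allI impI)
  \<comment> \<open>The extremal matchings use tiles of a single weight, so the interaction vanishes
    and the symmetric row sums give the value 0.\<close>
  have e: "ev l (od l {l..e}) = {}" "od l (od l {l..e}) = od l {l..e}"
    "od l (ev l {l..e}) = {}" "ev l (ev l {l..e}) = ev l {l..e}"
    by (auto simp: ev_def od_def)
  show "v_explicit (P_min G) = 0"
    unfolding P_min_eq v_explicit_matching_of[OF sub_ev_od(2) sparse_ev_od(2)] potential_def e
    using sum_od_row by simp
  show "v_explicit (P_max G) = 0"
    unfolding P_max_eq v_explicit_matching_of[OF sub_ev_od(1) sparse_ev_od(1)] potential_def e
    using sum_ev_row by (simp add: sum_subtractf algebra_simps)
next
  fix P p assume P: "P \<in> matchings G" and tw: "can_twist G P p"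
  then obtain S where S: "S \<subseteq> {l..e}" "sparse S" "P = matching_of l e S"
    by (auto simp: matchings_eq)
  from S(1,2) tw[unfolded S(3)] show "v_explicit P - v_explicit (twist p P) = Omega G p P"
  proof (cases rule: can_twist_cases)
    case 1
    have S': "S - {p} \<subseteq> {l..e}" "sparse (S - {p})" using S(1) sparse_subset[OF S(2)] by auto
    show ?thesis
      unfolding S(3) twist_remove[OF S(1,2) 1] v_explicit_matching_of[OF S(1,2)] v_explicit_matching_of[OF S']
      by (rule potential_twist[OF S(1,2) 1])
  next
    case 2
    have S': "insert p S \<subseteq> {l..e}" "sparse (insert p S)" using S 2 sparse_insert by auto
    have "insert p S - {p} = S" using 2 by auto
    then show ?thesis
      using potential_twist(2)[OF S', of p]
      unfolding S(3) twist_insert[OF 2] v_explicit_matching_of[OF S(1,2)] v_explicit_matching_of[OF S']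
      by simp
  qed
qed (simp add: v_explicit_def)

text \<open>Removing the tiles of weight 1 from \<open>S\<close> one by one and then inserting the missing tiles of
  weight 2 leads to the minimal matching by admissible twists.\<close>

lemma is_v_matching_of_eq:
  assumes f: "is_v G f" and g: "is_v G g" and S: "S \<subseteq> {l..e}" "sparse S"
  shows "f (matching_of l e S) = g (matching_of l e S)"
  using S
proof (induction "card (ev l S) + card (od l {l..e} - S)" arbitrary: S rule: less_induct)
  case less
  have fin: "finite S" using finite_sub less.prems(1) .
  have step: "h (matching_of l e S) - h (matching_of l e (S - {p})) = Omega G p (matching_of l e S)"
    if "is_v G h" "S \<subseteq> {l..e}" "sparse S" "p \<in> S" for h S p
    using that matching_of_in_matchings[OF that(2,3)] can_twist_if_mem[OF that(2-4)] twist_remove[OF that(2-4)]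
    unfolding is_v_def by metis
  consider p where "p \<in> ev l S" | p where "ev l S = {}" "p \<in> od l {l..e} - S"
    | "ev l S = {}" "od l {l..e} \<subseteq> S" by blast
  then show ?case
  proof cases
    case 1
    then have p: "p \<in> S" "even (p - l)" by (simp_all add: ev_def)
    have S': "S - {p} \<subseteq> {l..e}" "sparse (S - {p})" using less.prems sparse_subset by auto
    have "ev l (S - {p}) = ev l S - {p}" "od l {l..e} - (S - {p}) = od l {l..e} - S"
      using p by (auto simp: ev_def od_def)
    then have "card (ev l (S - {p})) + card (od l {l..e} - (S - {p})) < card (ev l S) + card (od l {l..e} - S)"
      using card_Diff1_less[OF _ 1] fin by simp
    from less.hyps[OF this S'] show ?thesis
      using step[OF f less.prems p(1)] step[OF g less.prems p(1)] by simp
  next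
    case 2
    let ?T = "insert p S"
    have p: "odd (p - l)" "p \<in> {l..e}" "p \<notin> S" using 2(2) by (auto simp: od_def)
    have S_odd: "odd (i - l)" if "i \<in> S" for i using 2(1) that unfolding ev_def by blast
    \<comment> \<open>Only weight 2 tiles remain in S, whereas the neighbours of \<open>p\<close>
      have weight 1.\<close>
    have "p - 1 \<notin> S" "p + 1 \<notin> S" using S_odd[of "p - 1"] S_odd[of "p + 1"] p(1) by auto
    then have T: "?T \<subseteq> {l..e}" "sparse ?T" using less.prems p(2) sparse_insert by auto
    have "ev l ?T = ev l S" "od l {l..e} - ?T = (od l {l..e} - S) - {p}"
      using p(1) by (auto simp: ev_def)
    then have "card (ev l ?T) + card (od l {l..e} - ?T) < card (ev l S) + card (od l {l..e} - S)"
      using card_Diff1_less[OF _ 2(2)] by simp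
    from less.hyps[OF this T] show ?thesis
      using step[OF f T, of p] step[OF g T, of p] p(3) by simp
  next
    case 3
    then have "S = od l {l..e}" using less.prems(1) unfolding ev_def od_def by blast
    then show ?thesis using f g by (simp add: is_v_def P_min_eq)
  qed
qed

lemma v_matching_of:
  assumes "S \<subseteq> {l..e}" "sparse S"
  shows "v G (matching_of l e S) = potential S"
proof -
  have "v G = v_explicit"
    unfolding v_def
  proof (rule the_equality)
    show "is_v G v_explicit" by (rule is_v_explicit)
  next
    fix f assume f: "is_v G f"
    show "f = v_explicit"
    proof
      fix P
      show "f P = v_explicit P"
      proof (cases "P \<in> matchings G")
        case True
        then show ?thesis using is_v_matching_of_eq[OF f is_v_explicit] by (auto simp: matchings_eq)
      next
        case False
        then show ?thesis using f by (simp add: is_v_def v_explicit_def)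
      qed
    qed
  qed
  then show ?thesis using v_explicit_matching_of[OF assms] by simp
qed

section \<open>Summation over dimension classes\<close>

lemma matchings_of_dim:
  "{P \<in> matchings G. dimP G P = (u, w)} =
     (if w \<le> card (od l {l..e})
      then matching_of l e ` sparse_subsets l e u (card (od l {l..e}) - w) else {})"
proof -
  have "dimP G (matching_of l e S) = (u, w) \<longleftrightarrow>
      w \<le> card (od l {l..e}) \<and> card (ev l S) = u \<and> card (od l S) = card (od l {l..e}) - w"
    if "S \<subseteq> {l..e}" "sparse S" for S
    using dimP_eq[OF that] by auto
  then show ?thesis unfolding matchings_eq sparse_subsets_def by auto
qed

text \<open>On a dimension class the size \<open>u\<close> of the weight 1 part is fixed, so the
  common shift \<open>u * (l + e)\<close> can be absorbed into \<open>g\<close>.\<close>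

lemma sum_alpha_eq_sum_v:
  fixes g :: "int \<Rightarrow> 'b :: comm_monoid_add"
  shows "(\<Sum>P \<in> {P \<in> matchings G. dimP G P = (u, w)}. g (alpha G P)) =
         (\<Sum>P \<in> {P \<in> matchings G. dimP G P = (u, w)}. g (v G P))"
proof (cases "w \<le> card (od l {l..e})")
  case True
  define c where "c = card (od l {l..e}) - w"
  let ?g = "\<lambda>x. g (x - int u * (l + e))"
  have inj: "inj_on (matching_of l e) A" for A
    using inj_matching_of by (rule inj_on_subset) simp
  have "(\<Sum>P \<in> matching_of l e ` sparse_subsets l e u c. g (alpha G P)) =
      (\<Sum>S \<in> sparse_subsets l e u c. ?g (\<Sum>(ev l S) + \<Sum>(od l S)))"
    unfolding sum.reindex[OF inj] by (intro sum.cong) (simp_all add: sparse_subsets_def alpha_eq)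
  also have "\<dots> = (\<Sum>S \<in> sparse_subsets l e u c.
      ?g (\<Sum>(ev l S) - \<Sum>(od l S) - 2 * (\<Sum>a\<in>ev l S. \<Sum>c\<in>od l S. sgn (a - c))))"
    using right_end by (rule sum_sparse_subsets_eq)
  also have "\<dots> = (\<Sum>P \<in> matching_of l e ` sparse_subsets l e u c. g (v G P))"
    unfolding sum.reindex[OF inj]
    by (intro sum.cong) (simp_all add: sparse_subsets_def v_matching_of potential_def algebra_simps)
  finally show ?thesis using True by (simp add: matchings_of_dim c_def)
next
  case False
  then show ?thesis by (simp add: matchings_of_dim)
qed

lemma a_vec_cong:
  assumes "P \<in> matchings G" "Q \<in> matchings G" "dimP G P = dimP G Q"
  shows "a_vec G P = a_vec G Q"
proof -
  obtain S T where S: "S \<subseteq> {l..e}" "sparse S" "P = matching_of l e S"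
    and T: "T \<subseteq> {l..e}" "sparse T" "Q = matching_of l e T"
    using assms(1,2) unfolding matchings_eq by auto
  then have "card (ev l S) = card (ev l T)" "card (od l S) = card (od l T)"
    using assms(3) dimP_eq[OF S(1,2)] dimP_eq[OF T(1,2)] by auto
  then show ?thesis using S T finite_sub by (simp add: a_vec_eq)
qed

lemma finite_matchings: "finite (matchings G)"
proof -
  have "finite {S. S \<subseteq> {l..e} \<and> sparse S}"
    by (rule finite_subset[of _ "Pow {l..e}"]) auto
  then show ?thesis unfolding matchings_eq by (rule finite_imageI)
qed

text \<open>The sum is grouped by dimension. By \<open>a_vec_cong\<close> X(P) is constant on each
  group, so the equality of the coefficient sums applies with that element as a fixed
  factor.\<close>

lemma expansion_eq:
  "(\<Sum>P \<in> matchings G. qt_mult \<Lambda> (qscalar (qpow (of_int (alpha G P) / 2))) (X_matching G P)) =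
   (\<Sum>P \<in> matchings G. qt_mult \<Lambda> (qscalar (qpow (of_int (v G P) / 2))) (X_matching G P))"
    (is "(\<Sum>P \<in> _. ?f (alpha G P) P) = (\<Sum>P \<in> _. ?f (v G P) P)")
proof -
  have "(\<Sum>P \<in> {P \<in> matchings G. dimP G P = d}. ?f (alpha G P) P) =
      (\<Sum>P \<in> {P \<in> matchings G. dimP G P = d}. ?f (v G P) P)" (is "?L = ?R") for d
  proof (cases "{P \<in> matchings G. dimP G P = d} = {}")
    case False
    then obtain Q where Q: "Q \<in> matchings G" "dimP G Q = d" by blast
    have X: "X_matching G P = X_matching G Q" if "P \<in> matchings G" "dimP G P = d" for P
      using a_vec_cong[of P Q] that Q by (simp add: X_matching_def)
    have "?L = (\<Sum>P \<in> {P \<in> matchings G. dimP G P = d}. ?f (alpha G P) Q)"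
      by (intro sum.cong) (simp_all add: X)
    also have "\<dots> = (\<Sum>P \<in> {P \<in> matchings G. dimP G P = d}. ?f (v G P) Q)"
      using sum_alpha_eq_sum_v[where g = "\<lambda>x. ?f x Q" and u = "fst d" and w = "snd d"] by simp
    also have "\<dots> = ?R"
      by (intro sum.cong) (simp_all add: X)
    finally show ?thesis .
  next
    case True
    show ?thesis unfolding True by simp
  qed
  then have "(\<Sum>d \<in> dimP G ` matchings G. \<Sum>P \<in> {P \<in> matchings G. dimP G P = d}. ?f (alpha G P) P) =
      (\<Sum>d \<in> dimP G ` matchings G. \<Sum>P \<in> {P \<in> matchings G. dimP G P = d}. ?f (v G P) P)"
    by simp
  then show ?thesis unfolding sum.image_gen[OF finite_matchings, symmetric] .
qed

end

lemma snake_row_Gsnake: "snake_row (Gsnake s) (- int s) (int s)"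
  by unfold_locales simp_all

lemma snake_row_Hsnake: "s \<ge> 1 \<Longrightarrow> snake_row (Hsnake s) (- int s) (int s - 1)"
  by unfold_locales simp_all

theorem mainTheorem5:
  shows "(\<forall>\<G>. (\<exists>s\<ge>0. \<G> = Gsnake s) \<or> (\<exists>s\<ge>1. \<G> = Hsnake s) \<longrightarrow>
           (\<forall>u w :: nat.
              (\<Sum>P \<in> {P \<in> matchings \<G>. dimP \<G> P = (u, w)}. qpow (of_int (alpha \<G> P) / 2)) =
              (\<Sum>P \<in> {P \<in> matchings \<G>. dimP \<G> P = (u, w)}. qpow (of_int (v \<G> P) / 2))))
       \<and> (\<forall>s \<Lambda>. kronecker_form \<Lambda> \<longrightarrow>
           (\<Sum>P \<in> matchings (Gsnake s).
              qt_mult \<Lambda> (qscalar (qpow (of_int (alpha (Gsnake s) P) / 2))) (X_matching (Gsnake s) P)) =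
           (\<Sum>P \<in> matchings (Gsnake s).
              qt_mult \<Lambda> (qscalar (qpow (of_int (v (Gsnake s) P) / 2))) (X_matching (Gsnake s) P)))"
proof (intro conjI allI impI)
  fix \<G> :: snake and u w :: nat
  assume "(\<exists>s\<ge>0. \<G> = Gsnake s) \<or> (\<exists>s\<ge>1. \<G> = Hsnake s)"
  then obtain l e where "snake_row \<G> l e"
    using snake_row_Gsnake snake_row_Hsnake by blast
  then show "(\<Sum>P \<in> {P \<in> matchings \<G>. dimP \<G> P = (u, w)}. qpow (of_int (alpha \<G> P) / 2)) =
      (\<Sum>P \<in> {P \<in> matchings \<G>. dimP \<G> P = (u, w)}. qpow (of_int (v \<G> P) / 2))"
    by (rule snake_row.sum_alpha_eq_sum_v)
next
  fix s \<Lambda>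
  show "(\<Sum>P \<in> matchings (Gsnake s).
        qt_mult \<Lambda> (qscalar (qpow (of_int (alpha (Gsnake s) P) / 2))) (X_matching (Gsnake s) P)) =
      (\<Sum>P \<in> matchings (Gsnake s).
        qt_mult \<Lambda> (qscalar (qpow (of_int (v (Gsnake s) P) / 2))) (X_matching (Gsnake s) P))"
    by (rule snake_row.expansion_eq[OF snake_row_Gsnake])
qed

end
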